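(* Let $a,b>0$, let $\mathcal{E}$ be the ellipse $\frac{x^2}{a}+\frac{y^2}{b}=1$ in the Minkowski plane, let $\gamma\in\mathbb{R}\setminus\{-b,0,a\}$, $\varepsilon=\operatorname{sign}\gamma$, and let $n\ge2$ be an integer. Write the Taylor expansions around $x=0$ $$\frac{\sqrt{\varepsilon(a-x)(b+x)(\gamma-x)}}{\gamma-x}=\sum_{k\ge0}C_kx^k,\quad \frac{\sqrt{\varepsilon(a-x)(b+x)(\gamma-x)}}{a-x}=\sum_{k\ge0}D_kx^k,\quad \frac{\sqrt{\varepsilon(a-x)(b+x)(\gamma-x)}}{b+x}=\sum_{k\ge0}E_kx^k.$$ A billiard trajectory within $\mathcal{E}$ with caustic $\mathcal{C}_\gamma$ is $n$-elliptic periodic without being $n$-periodic if and only if one of the following conditions is satisfied: (a) $\mathcal{C}_\gamma$ is an ellipse, $0<\gamma<a$, and - for $n=2m$ even: $\det(D_{i+j-1})_{1\le i,j\le m}=0$ (that is, $D_1=0$ for $n=2$, $\begin{vmatrix} D_1 & D_2 \\ D_2 & D_3 \end{vmatrix}=0$ for $n=4$, etc.); - for $n=2m+1$ odd: $\det(E_{i+j})_{1\le i,j\le m}=0$ (that is, $E_2=0$ for $n=3$, $\begin{vmatrix} E_2 & E_3 \\ E_3 & E_4 \end{vmatrix}=0$ for $n=5$, etc.); (b) $\mathcal{C}_\gamma$ is an ellipse, $-b<\gamma<0$, and - for $n=2m$ even: $\det(E_{i+j-1})_{1\le i,j\le m}=0$; - for $n=2m+1$ odd: $\det(D_{i+j})_{1\le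 i,j\le m}=0$; (c) $\mathcal{C}_\gamma$ is a hyperbola, $n=2m$ is even, and $\det(C_{i+j-1})_{1\le i,j\le m}=0$; (d) $\mathcal{C}_\gamma$ is a hyperbola, $n=2m+1$ is odd, and $\det(D_{i+j})_{1\le i,j\le m}=0$; (e) $\mathcal{C}_\gamma$ is a hyperbola, $n=2m+1$ is odd, and $\det(E_{i+j})_{1\le i,j\le m}=0$.
   Context: The Minkowski plane is $\mathbb{R}^2$ with the scalar product $\langle X,Y\rangle=X_1Y_1-X_2Y_2$; vectors $X,Y$ are orthogonal if $\langle X,Y\rangle=0$, and $v$ is light-like if $\langle v,v\rangle=0$. The family of conics confocal with $\mathcal{E}$ is $\mathcal{C}_\lambda:\ \frac{x^2}{a-\lambda}+\frac{y^2}{b+\lambda}=1$, $\lambda\in\mathbb{R}$; $\mathcal{C}_\lambda$ is an ellipse for $\lambda\in(-b,a)$ and a hyperbola for $\lambda<-b$ or $\lambda>a$. Billiard reflection: given a line $p$ that is not light-like and a vector $v$, write $v=u+w$ with $u$ parallel to $p$ and $w$ orthogonal to $p$ (in the Minkowski sense); the reflection of $v$ on $p$ is $u-w$. A billiard trajectory within $\mathcal{E}$ is a polygonal line with vertices on $\mathcal{E}$ such that the directions of consecutive segments are billiard reflections of each other with respect to the tangent line of $\mathcal{E}$ at the common vertex (the reflection is not defined where this tangent line is light-like). All lines containing segments of a given trajectory are tangent to the same conic $\mathcal{C}_\gamma$ of the confocal family, called the caustic of the trajectory; the caustic is non-degenerate when $\gamma\in\mathbb{R}\setminus\{-b,a\}$.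 A trajectory is $n$-periodic if it closes after $n$ reflections ($n$ is not required to be the minimal such number). Elliptic coordinates: a point inside $\mathcal{E}$ has elliptic coordinates $(\lambda_1,\lambda_2)$, $-b\le\lambda_1\le0\le\lambda_2\le a$, the parameters of the two conics $\mathcal{C}_{\lambda_1},\mathcal{C}_{\lambda_2}$ of the confocal family through it (with degenerate conics $\mathcal{C}_{-b}$, $\mathcal{C}_{a}$ being the $x$-axis and the $y$-axis); points symmetric with respect to the coordinate axes have the same elliptic coordinates. A billiard trajectory is $n$-elliptic periodic if it is $n$-periodic in elliptic coordinates, i.e. the motion expressed in the coordinates $(\lambda_1,\lambda_2)$ closes after $n$ reflections. *)

theory Defs
  imports "HOL-Analysis.Analysis" "Jordan_Normal_Form.Determinant"
begin

section \<open>The Minkowski plane\<close>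

definition mink :: "real \<times> real \<Rightarrow> real \<times> real \<Rightarrow> real" where
  "mink X Y = fst X * fst Y - snd X * snd Y"

definition light_like :: "real \<times> real \<Rightarrow> bool" where
  "light_like v \<longleftrightarrow> mink v v = 0"

definition parallel_to_line :: "real \<times> real \<Rightarrow> (real \<times> real) set \<Rightarrow> bool" where
  "parallel_to_line u L \<longleftrightarrow> (\<exists>X\<in>L. \<exists>Y\<in>L. u = Y - X)"

definition orthogonal_to_line :: "real \<times> real \<Rightarrow> (real \<times> real) set \<Rightarrow> bool" where
  "orthogonal_to_line w L \<longleftrightarrow> (\<forall>u. parallel_to_line u L \<longrightarrow> mink w u = 0)"

definition light_like_line :: "(real \<times> real) set \<Rightarrow> bool" where
  "light_like_line L \<longleftrightarrow> (\<exists>u. parallel_to_line u L \<and> u \<noteq> 0 \<and> light_like u)"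

definition mink_reflection :: "(real \<times> real) set \<Rightarrow> real \<times> real \<Rightarrow> real \<times> real \<Rightarrow> bool" where
  "mink_reflection L v v' \<longleftrightarrow> \<not> light_like_line L \<and>
     (\<exists>u w. parallel_to_line u L \<and> orthogonal_to_line w L \<and> v = u + w \<and> v' = u - w)"


section \<open>The confocal family\<close>

text \<open>The ellipse of the billiard table is the member with parameter 0. The degenerate members
  for the parameters \<open>a\<close> and \<open>- b\<close> are the \<open>y\<close>-axis and the \<open>x\<close>-axis.\<close>

definition confocal_conic :: "real \<Rightarrow> real \<Rightarrow> real \<Rightarrow> (real \<times> real) set" where
  "confocal_conic a b l =
     (if l = a then {(x, y). x = 0}
      else if l = - b then {(x, y). y = 0}
      else {(x, y). x\<^sup>2 / (a - l) + y\<^sup>2 / (b + l) = 1})"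

text \<open>For a non-degenerate parameter \<open>l\<close>, \<open>conic_tangent a b l x0 y0 z0\<close> is the affine part of the
  tangent line of the projective closure of the conic at the point \<open>(x0 : y0 : z0)\<close>.
  For \<open>z0 = 1\<close> this is the tangent line at the affine point \<open>(x0, y0)\<close>; the points with \<open>z0 = 0\<close> are
  the points at infinity of a hyperbola, with the asymptotes as tangent lines. Asymptotes
  have to be admitted: a trajectory whose caustic is a hyperbola may have a segment through the
  centre of the table.\<close>

definition conic_tangent ::
    "real \<Rightarrow> real \<Rightarrow> real \<Rightarrow> real \<Rightarrow> real \<Rightarrow> real \<Rightarrow> (real \<times> real) set" where
  "conic_tangent a b l x0 y0 z0 = {(x, y). x0 * x / (a - l) + y0 * y / (b + l) = z0}"

definition tangent_to_conic :: "real \<Rightarrow> real \<Rightarrow> real \<Rightarrow> (real \<times> real) set \<Rightarrow> bool" where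
  "tangent_to_conic a b l L \<longleftrightarrow>
     (\<exists>x0 y0 z0. (x0, y0, z0) \<noteq> (0, 0, 0) \<and> x0\<^sup>2 / (a - l) + y0\<^sup>2 / (b + l) = z0\<^sup>2 \<and>
        L = conic_tangent a b l x0 y0 z0)"


section \<open>Billiard trajectories\<close>

text \<open>A trajectory is given by its consecutive vertices. The positive factor \<open>c\<close> expresses that
  only the directions of consecutive segments are related by the reflection.\<close>

definition billiard_trajectory :: "real \<Rightarrow> real \<Rightarrow> (nat \<Rightarrow> real \<times> real) \<Rightarrow> bool" where
  "billiard_trajectory a b P \<longleftrightarrow>
     (\<forall>k. P k \<in> confocal_conic a b 0 \<and> P (Suc k) \<noteq> P k \<and>
        (\<exists>c>0. mink_reflection
                 (conic_tangent a b 0 (fst (P (Suc k))) (snd (P (Suc k))) 1)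
                 (P (Suc k) - P k) (c *\<^sub>R (P (Suc (Suc k)) - P (Suc k)))))"

definition has_caustic :: "real \<Rightarrow> real \<Rightarrow> real \<Rightarrow> (nat \<Rightarrow> real \<times> real) \<Rightarrow> bool" where
  "has_caustic a b g P \<longleftrightarrow> (\<forall>k. tangent_to_conic a b g (affine hull {P k, P (Suc k)}))"

definition periodic_trajectory :: "nat \<Rightarrow> (nat \<Rightarrow> real \<times> real) \<Rightarrow> bool" where
  "periodic_trajectory n P \<longleftrightarrow> (\<forall>k. P (k + n) = P k)"


section \<open>Elliptic coordinates and elliptic periodicity\<close>

text \<open>On the boundary of the table one of the two coordinates is 0; at its points with light-like
  tangent both are, and there a single conic of the family passes through the point.\<close>

definition is_elliptic_coordinates :: "real \<Rightarrow> real \<Rightarrow> real \<times> real \<Rightarrow> real \<times> real \<Rightarrow> bool" where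
  "is_elliptic_coordinates a b X p \<longleftrightarrow>
     - b \<le> fst p \<and> fst p \<le> 0 \<and> 0 \<le> snd p \<and> snd p \<le> a \<and>
     {l. X \<in> confocal_conic a b l} = {fst p, snd p}"

definition elliptic_coordinates :: "real \<Rightarrow> real \<Rightarrow> real \<times> real \<Rightarrow> real \<times> real" where
  "elliptic_coordinates a b X = (THE p. is_elliptic_coordinates a b X p)"

lemma mem_confocal_conic_iff:
  fixes a b :: real
  assumes "a > 0" "b > 0"
  shows "(x, y) \<in> confocal_conic a b l \<longleftrightarrow> (a - l) * (b + l) - x\<^sup>2 * (b + l) - y\<^sup>2 * (a - l) = 0"
proof -
  consider "l = a" | "l = - b" | "l \<noteq> a" "l \<noteq> - b" by blast
  then show ?thesis
  proof cases
    case 1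
    then show ?thesis using assms by (simp add: confocal_conic_def)
  next
    case 2
    then show ?thesis using assms by (simp add: confocal_conic_def)
  next
    case 3
    then have "a - l \<noteq> 0" "b + l \<noteq> 0" by auto
    then have "x\<^sup>2 / (a - l) + y\<^sup>2 / (b + l) = 1 \<longleftrightarrow>
        x\<^sup>2 * (b + l) + y\<^sup>2 * (a - l) = (a - l) * (b + l)"
      by (simp add: add_frac_eq divide_eq_eq)
    then show ?thesis using 3 by (auto simp: confocal_conic_def)
  qed
qed

lemma elliptic_coordinates_ex1:
  fixes a b :: real
  assumes ab: "a > 0" "b > 0" and inside: "x\<^sup>2 / a + y\<^sup>2 / b \<le> 1"
  shows "\<exists>!p. is_elliptic_coordinates a b (x, y) p"
proof -
  define f where "f l = (a - l) * (b + l) - x\<^sup>2 * (b + l) - y\<^sup>2 * (a - l)" for l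
  have cont: "continuous_on S f" for S unfolding f_def by (intro continuous_intros)
  have f0: "f 0 \<ge> 0" using inside ab by (simp add: f_def field_simps)
  have fa: "f a \<le> 0" using ab by (simp add: f_def)
  have fb: "f (- b) \<le> 0" using ab by (simp add: f_def)
  have roots: "{l. (x, y) \<in> confocal_conic a b l} = {l. f l = 0}"
    using mem_confocal_conic_iff[OF ab] by (simp add: f_def)
  obtain u where u: "- b \<le> u" "u \<le> 0" "f u = 0"
    using IVT'[of f "- b" 0 0] fb f0 ab cont by force
  define v where "v = a - b - x\<^sup>2 + y\<^sup>2 - u"
  have "f l - f u = - (l - u) * (l - v)" for l
    unfolding f_def v_def by (simp add: power2_eq_square algebra_simps)
  then have fac: "f l = - (l - u) * (l - v)" for l using u by simp
  have set: "{l. f l = 0} = {u, v}" by (auto simp: fac)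
  have uv: "u * v \<le> 0" using f0 fac[of 0] by simp
  have "(a - u) * (a - v) \<ge> 0" using fa fac[of a] by (simp add: algebra_simps)
  then have va: "v \<le> a" using u ab by (simp add: zero_le_mult_iff)
  have vb: "- b \<le> v"
  proof (cases "u = - b")
    case True
    then have "0 \<le> v" using uv ab by (simp add: zero_le_mult_iff)
    then show ?thesis using ab by simp
  next
    case False
    have "(b + u) * (b + v) \<ge> 0" using fb fac[of "- b"] by (simp add: algebra_simps)
    then show ?thesis using u False by (simp add: zero_le_mult_iff)
  qed
  show ?thesis
  proof (rule ex1I)
    show "is_elliptic_coordinates a b (x, y) (min u v, max u v)"
      unfolding is_elliptic_coordinates_def roots set
      using u va vb uv ab by (auto simp: min_def max_def mult_le_0_iff)
  next
    fix p assume "is_elliptic_coordinates a b (x, y) p"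
    then have "fst p \<le> snd p" "{u, v} = {fst p, snd p}"
      unfolding is_elliptic_coordinates_def roots set by auto
    then show "p = (min u v, max u v)"
      by (cases p) (auto simp: doubleton_eq_iff min_def max_def)
  qed
qed

text \<open>The motion, and not only the sequence of vertices, has to close in elliptic coordinates.
  Comparing the segments \<open>k\<close> and \<open>k + n\<close> through their affine parameters is no restriction:
  the reflection preserves \<open>mink v v\<close>, so if the motion with reflected velocity vectors repeats
  itself in elliptic coordinates, then both segments are traversed in the same time.\<close>

definition elliptic_periodic ::
    "real \<Rightarrow> real \<Rightarrow> nat \<Rightarrow> (nat \<Rightarrow> real \<times> real) \<Rightarrow> bool" where
  "elliptic_periodic a b n P \<longleftrightarrow>
     (\<forall>k. \<forall>t\<in>{0..1}.
        elliptic_coordinates a b ((1 - t) *\<^sub>R P (k + n) + t *\<^sub>R P (Suc (k + n))) =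
        elliptic_coordinates a b ((1 - t) *\<^sub>R P k + t *\<^sub>R P (Suc k)))"


section \<open>Taylor coefficients and Hankel determinants\<close>

definition taylor_coeff :: "(real \<Rightarrow> real) \<Rightarrow> nat \<Rightarrow> real" where
  "taylor_coeff f k = (deriv ^^ k) f 0 / fact k"

definition root_fun :: "real \<Rightarrow> real \<Rightarrow> real \<Rightarrow> real \<Rightarrow> real" where
  "root_fun a b g x = sqrt (sgn g * (a - x) * (b + x) * (g - x))"

definition coeff_C :: "real \<Rightarrow> real \<Rightarrow> real \<Rightarrow> nat \<Rightarrow> real" where
  "coeff_C a b g = taylor_coeff (\<lambda>x. root_fun a b g x / (g - x))"

definition coeff_D :: "real \<Rightarrow> real \<Rightarrow> real \<Rightarrow> nat \<Rightarrow> real" where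
  "coeff_D a b g = taylor_coeff (\<lambda>x. root_fun a b g x / (a - x))"

definition coeff_E :: "real \<Rightarrow> real \<Rightarrow> real \<Rightarrow> nat \<Rightarrow> real" where
  "coeff_E a b g = taylor_coeff (\<lambda>x. root_fun a b g x / (b + x))"

text \<open>\<open>hankel_det s m c\<close> is the determinant of the matrix with entries \<open>c (i + j + s)\<close> for
  \<open>0 \<le> i, j < m\<close>. With indices running from 1 to \<open>m\<close>, as is usual, the entries are
  \<open>c (i + j - 1)\<close> for \<open>s = 1\<close> and \<open>c (i + j)\<close> for \<open>s = 2\<close>.\<close>

definition hankel_det :: "nat \<Rightarrow> nat \<Rightarrow> (nat \<Rightarrow> real) \<Rightarrow> real" where
  "hankel_det s m c = Determinant.det (mat m m (\<lambda>(i, j). c (i + j + s)))"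

end

theory Submission
  imports Defs "HOL-Computational_Algebra.Computational_Algebra"
    "HOL-Computational_Algebra.Field_as_Ring"
begin

text \<open>The billiard has a Lax pair. A segment through the vertex \<open>(x, y)\<close> with velocity \<open>(u, v)\<close> is
  encoded by a traceless 2 by 2 matrix \<open>L(z)\<close>, quadratic in the spectral parameter, whose square is the
  scalar \<open>f(z) = sgn \<gamma> (a - z)(b + z)(\<gamma> - z)\<close>. It depends on \<open>x, u\<close> and on \<open>y, v\<close> only up to a common
  sign, so it describes the motion in elliptic coordinates. One step of the billiard conjugates \<open>L\<close> by
  a matrix of determinant \<open>z\<^sup>2\<close> which at \<open>z = a\<close> and \<open>z = - b\<close> acts on the vectors \<open>(x, u)\<close> and \<open>(y, v)\<close>
  themselves; let \<open>M\<close> be the product of \<open>n\<close> such matrices.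

  If the motion is \<open>n\<close>-periodic in elliptic coordinates, then \<open>M\<close> commutes with \<open>L\<close>, so \<open>M = p + q L\<close>
  and \<open>p\<^sup>2 - q\<^sup>2 f = z\<^sup>2\<^sup>n\<close>. The signs by which the two coordinates change are those of \<open>p\<close> at \<open>a\<close> and
  \<open>- b\<close> and determine how \<open>(p - z\<^sup>n)(p + z\<^sup>n) = q\<^sup>2 f\<close> splits. Unless both signs are positive this
  yields a Pell equation \<open>h' s\<^sup>2 - h r\<^sup>2 = c z\<^sup>n\<close> with \<open>h h' = f\<close> and \<open>h\<close> linear, that is a Pade
  approximant \<open>r / s\<close> of \<open>\<surd>f / h\<close>, which exists if and only if a Hankel determinant vanishes. The
  equation at the roots of \<open>f\<close> excludes the choices of \<open>h\<close> that do not occur in the theorem.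
  Conversely, squaring \<open>s \<surd>f - r h\<close> gives \<open>p\<close> and \<open>q\<close>, and \<open>p + q L\<close> equals \<open>M\<close> up to a
  factor because the two matrices degenerate in the same way at \<open>z = 0\<close>.\<close>

hide_const (open) Module.smult

section \<open>Taylor coefficients as formal power series\<close>

lemma taylor_coeff_eq_fps_nth:
  assumes "f has_fps_expansion F"
  shows "taylor_coeff f k = fps_nth F k"
proof -
  have "(deriv ^^ k) f has_fps_expansion (fps_deriv ^^ k) F"
    by (induction k) (auto intro: assms has_fps_expansion_deriv)
  then have "eval_fps ((fps_deriv ^^ k) F) 0 = (deriv ^^ k) f 0"
    unfolding has_fps_expansion_def using eventually_nhds_x_imp_x by fastforce
  moreover have "(fps_deriv ^^ k) G = fps_nth_deriv k G" for G :: "real fps"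
  proof (induction k)
    case (Suc k)
    then show ?case by (simp add: fps_nth_deriv_commute del: fps_nth_deriv.simps)
  qed simp
  ultimately show ?thesis
    by (simp add: taylor_coeff_def eval_fps_at_0 fps_deriv_maclauren_0 field_simps)
qed

lemma has_fps_expansion_unique:
  fixes f :: "real \<Rightarrow> real"
  assumes "f has_fps_expansion F" "g has_fps_expansion G" "\<forall>\<^sub>F x in nhds 0. f x = g x"
  shows "F = G"
proof -
  have "g has_fps_expansion F"
    using assms(1,3) unfolding has_fps_expansion_def by (auto elim: eventually_elim2)
  then show ?thesis
    using assms(2) by (metis fps_ext taylor_coeff_eq_fps_nth)
qed

lemma has_fps_expansion_poly: "poly p has_fps_expansion fps_of_poly p"
  for p :: "real poly"
  by (simp add: has_fps_expansion_def)

lemma has_fps_expansion_sqrt_linear: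
  fixes c d :: real
  assumes "c > 0"
  obtains F where "(\<lambda>x. sqrt (c + d * x)) has_fps_expansion F"
proof
  \<comment> \<open>These are the coefficients of the generalised binomial series of
    \<open>(c + d * x) powr (1 / 2)\<close>, which converges for
    \<open>\<bar>d * x\<bar> < c\<close>.\<close>
  let ?F = "Abs_fps (\<lambda>n. ((1 / 2) gchoose n) * c powr (1 / 2 - real n) * d ^ n)"
  have "((\<lambda>x. \<bar>d * x\<bar>) \<longlongrightarrow> \<bar>d * 0\<bar>) (nhds 0)"
    by (intro tendsto_intros filterlim_ident)
  then have "\<forall>\<^sub>F x in nhds 0. \<bar>d * x\<bar> < c"
    using assms by (intro order_tendstoD) auto
  then show "(\<lambda>x. sqrt (c + d * x)) has_fps_expansion ?F"
  proof (intro has_fps_expansionI, eventually_elim)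
    case (elim x)
    then have "(\<lambda>n. ((1 / 2) gchoose n) * c powr (1 / 2 - real n) * (d * x) ^ n)
        sums (c + d * x) powr (1 / 2)"
      using gen_binomial_real''[of "d * x" c "1 / 2"] by (simp add: add.commute)
    moreover have "(c + d * x) powr (1 / 2) = sqrt (c + d * x)"
      using elim by (intro powr_half_sqrt) auto
    ultimately show ?case
      by (simp add: power_mult_distrib mult.assoc)
  qed
qed

text \<open>The radicand of \<open>root_fun\<close>. For positive \<open>a\<close> and
  \<open>b\<close> the factor \<open>sgn g\<close> makes its value at 0 equal to
  \<open>a * b * \<bar>g\<bar>\<close>, which is positive, so that a square root analytic at 0
  exists.\<close>

definition cubic :: "real \<Rightarrow> real \<Rightarrow> real \<Rightarrow> real poly" where
  "cubic a b g = smult (sgn g) ([:a, -1:] * [:b, 1:] * [:g, -1:])"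

lemma poly_cubic: "poly (cubic a b g) z = sgn g * (a - z) * (b + z) * (g - z)"
  by (simp add: cubic_def algebra_simps)

lemma degree_cubic: "g \<noteq> 0 \<Longrightarrow> degree (cubic a b g) = 3"
  and cubic_neq_0: "g \<noteq> 0 \<Longrightarrow> cubic a b g \<noteq> 0"
  by (auto simp: cubic_def sgn_zero_iff)

lemma cubic_factor: "cubic a b g = smult (sgn g) ([:- a, 1:] * [:b, 1:] * [:- g, 1:])"
  by (rule poly_ext) (simp add: poly_cubic, simp add: algebra_simps)

text \<open>The roots \<open>a\<close>, \<open>- b\<close>, \<open>g\<close> are distinct. Later
  this keeps the entries of the Lax matrix from having a common zero.\<close>

lemma pderiv_cubic_neq_0:
  assumes "a > 0" "b > 0" "g \<noteq> 0" "g \<noteq> a" "g \<noteq> - b" "poly (cubic a b g) z = 0"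
  shows "poly (pderiv (cubic a b g)) z \<noteq> 0"
proof -
  have "poly (pderiv (cubic a b g)) z =
      sgn g * ((a - z) * (g - z) - (b + z) * (g - z) - (a - z) * (b + z))"
    by (simp add: cubic_def pderiv_mult pderiv_smult pderiv_pCons algebra_simps)
  moreover have "z = a \<or> z = - b \<or> z = g"
    using assms by (auto simp: poly_cubic sgn_zero_iff)
  ultimately show ?thesis
    using assms by (auto simp: sgn_zero_iff)
qed

text \<open>A single series \<open>Y\<close> serves all three families of Taylor coefficients, which
  differ only in the linear polynomial \<open>h\<close> dividing it.\<close>

lemma root_fun_series:
  fixes a b g :: real
  assumes "a > 0" "b > 0" "g \<noteq> 0"
  obtains Y where "Y * Y = fps_of_poly (cubic a b g)" "fps_nth Y 0 > 0"
    "\<And>h k. poly h 0 \<noteq> 0 \<Longrightarrow>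
       taylor_coeff (\<lambda>x. root_fun a b g x / poly h x) k = fps_nth (Y / fps_of_poly h) k"
proof -
  obtain F1 where F1: "(\<lambda>x. sqrt (a + (-1) * x)) has_fps_expansion F1"
    using has_fps_expansion_sqrt_linear assms by blast
  obtain F2 where F2: "(\<lambda>x. sqrt (b + 1 * x)) has_fps_expansion F2"
    using has_fps_expansion_sqrt_linear assms by blast
  \<comment> \<open>Rewriting \<open>sgn g * (g - x)\<close> as
    \<open>\<bar>g\<bar> - sgn g * x\<close> makes the third factor positive at 0 like the other
    two.\<close>
  obtain F3 where F3: "(\<lambda>x. sqrt (\<bar>g\<bar> + (- sgn g) * x)) has_fps_expansion F3"
    using has_fps_expansion_sqrt_linear assms by (metis zero_less_abs_iff)
  have "root_fun a b g = (\<lambda>x. sqrt (a + (-1) * x) * sqrt (b + 1 * x) * sqrt (\<bar>g\<bar> + (- sgn g) * x))"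
    by (simp add: root_fun_def fun_eq_iff abs_sgn algebra_simps flip: real_sqrt_mult)
  then have Y: "root_fun a b g has_fps_expansion (F1 * F2 * F3)"
    using F1 F2 F3 by (simp only: has_fps_expansion_mult)
  define Y where "Y = F1 * F2 * F3"
  note Y = Y[folded Y_def]
  have Y0: "fps_nth Y 0 = root_fun a b g 0"
    using taylor_coeff_eq_fps_nth[OF Y, of 0] by (simp add: taylor_coeff_def)
  have pos: "poly (cubic a b g) 0 > 0"
    using assms by (simp add: poly_cubic sgn_if mult_less_0_iff)
  have "(poly (cubic a b g) \<longlongrightarrow> poly (cubic a b g) 0) (nhds 0)"
    using tendsto_nhds_iff isCont_def by (metis poly_isCont)
  then have "\<forall>\<^sub>F x in nhds 0. 0 < poly (cubic a b g) x"
    using pos by (intro order_tendstoD) auto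
  then have "\<forall>\<^sub>F x in nhds 0. root_fun a b g x * root_fun a b g x = poly (cubic a b g) x"
    by eventually_elim (simp add: root_fun_def poly_cubic)
  then have "Y * Y = fps_of_poly (cubic a b g)"
    by (rule has_fps_expansion_unique[OF has_fps_expansion_mult[OF Y Y] has_fps_expansion_poly])
  moreover have "fps_nth Y 0 > 0"
    using pos by (simp add: Y0 root_fun_def poly_cubic)
  moreover have "taylor_coeff (\<lambda>x. root_fun a b g x / poly h x) k = fps_nth (Y / fps_of_poly h) k"
    if "poly h 0 \<noteq> 0" for h k
    using that
    by (intro taylor_coeff_eq_fps_nth has_fps_expansion_divide' Y has_fps_expansion_poly)
       (simp add: poly_0_coeff_0)
  ultimately show ?thesis using that by blast
qed

section \<open>Hankel determinants and Pade approximation\<close>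

text \<open>There are \<open>m + K\<close> linear conditions on the \<open>m + K\<close>
  coefficients of \<open>s\<close> and \<open>r\<close>, so a nonzero solution is exceptional and
  detected by a determinant.\<close>

definition pade :: "nat \<Rightarrow> nat \<Rightarrow> real fps \<Rightarrow> real poly \<Rightarrow> real poly \<Rightarrow> bool" where
  "pade m K F s r \<longleftrightarrow> s \<noteq> 0 \<and> degree s < m \<and> degree r < K \<and>
     fps_X ^ (m + K) dvd F * fps_of_poly s - fps_of_poly r"

lemma fps_X_power_dvd_iff:
  fixes F :: "real fps"
  shows "fps_X ^ n dvd F \<longleftrightarrow> (\<forall>k<n. fps_nth F k = 0)"
proof
  assume "\<forall>k<n. fps_nth F k = 0"
  then have "F = fps_X ^ n * fps_shift n F"
    by (intro fps_ext) (simp add: fps_X_power_mult_nth)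
  then show "fps_X ^ n dvd F" by (metis dvd_triv_left)
qed (auto simp: fps_X_power_mult_nth elim!: dvdE)

text \<open>The lowest \<open>m + d\<close> coefficients of \<open>F * s\<close> are absorbed by
  \<open>r\<close>. The next \<open>m\<close> must vanish, which is a homogeneous Hankel system for
  the coefficients of \<open>s\<close> in reverse order.\<close>

lemma hankel_det_eq_0_iff_pade:
  assumes "m > 0"
  shows "hankel_det (Suc d) m (fps_nth F) = 0 \<longleftrightarrow> (\<exists>s r. pade m (m + d) F s r)"
proof -
  let ?A = "mat m m (\<lambda>(i, j). fps_nth F (i + j + Suc d))"
  have A: "?A \<in> carrier_mat m m" by simp
  have coeff: "fps_nth (F * fps_of_poly s) (m + d + i) =
      (\<Sum>j<m. fps_nth F (i + j + Suc d) * coeff s (m - 1 - j))"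
    if s: "degree s < m" for s i
  proof -
    have "fps_nth (F * fps_of_poly s) (m + d + i) =
        (\<Sum>l=0..m + d + i. coeff s l * fps_nth F (m + d + i - l))"
      by (simp add: mult.commute[of F] fps_mult_nth)
    also have "\<dots> = (\<Sum>l<m. coeff s l * fps_nth F (m + d + i - l))"
      using s by (intro sum.mono_neutral_right) (auto simp: coeff_eq_0)
    also have "\<dots> = (\<Sum>j<m. fps_nth F (i + j + Suc d) * coeff s (m - 1 - j))"
      by (rule sum.reindex_bij_witness[of _ "\<lambda>j. m - 1 - j" "\<lambda>j. m - 1 - j"])
         (auto intro!: arg_cong2[where f = "(*)"] arg_cong[where f = "fps_nth F"])
    finally show ?thesis .
  qed
  have mult: "?A *\<^sub>v v = 0\<^sub>v m \<longleftrightarrow> (\<forall>i<m. (\<Sum>j<m. fps_nth F (i + j + Suc d) * vec_index v j) = 0)"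
    if "v \<in> carrier_vec m" for v
    using that by (auto simp: vec_eq_iff scalar_prod_def atLeast0LessThan)
  show ?thesis
  proof
    assume "hankel_det (Suc d) m (fps_nth F) = 0"
    then obtain v where v: "v \<in> carrier_vec m" "v \<noteq> 0\<^sub>v m" "?A *\<^sub>v v = 0\<^sub>v m"
      using det_0_iff_vec_prod_zero_field[OF A] unfolding hankel_det_def by auto
    define s where "s = Poly (map (\<lambda>k. vec_index v (m - 1 - k)) [0..<m])"
    have cs: "coeff s k = (if k < m then vec_index v (m - 1 - k) else 0)" for k
      by (simp add: s_def coeff_Poly_eq nth_default_def)
    have "degree s \<le> m - 1"
      by (rule degree_le) (auto simp: cs)
    then have ds: "degree s < m" using assms by simp
    \<comment> \<open>\<open>r\<close> truncates \<open>F * s\<close>, so that only the coefficients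
      from position \<open>m + d\<close> on remain to be checked.\<close>
    define r where "r = poly_of_list (map (fps_nth (F * fps_of_poly s)) [0..<m + d])"
    have cr: "coeff r k = (if k < m + d then fps_nth (F * fps_of_poly s) k else 0)" for k
      by (simp add: r_def coeff_Poly_eq nth_default_def del: upt_Suc)
    have "degree r \<le> m + d - 1"
      by (rule degree_le) (auto simp: cr)
    then have dr: "degree r < m + d" using assms by simp
    have "s \<noteq> 0"
    proof
      assume "s = 0"
      then have "vec_index v (m - 1 - k) = 0" if "k < m" for k using cs[of k] that by simp
      then have "vec_index v k = 0" if "k < m" for k
        using that \<open>m > 0\<close> by (metis diff_diff_cancel diff_less less_Suc_eq_le Suc_pred' diff_less_Suc Suc_diff_1)
      then show False using v by auto
    qed
    moreover have "fps_X ^ (m + (m + d)) dvd F * fps_of_poly s - fps_of_poly r"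
      unfolding fps_X_power_dvd_iff
    proof (intro allI impI)
      fix k assume k: "k < m + (m + d)"
      show "fps_nth (F * fps_of_poly s - fps_of_poly r) k = 0"
      proof (cases "k < m + d")
        case False
        then obtain i where i: "k = m + d + i" by (metis not_less le_Suc_ex)
        then have "i < m" using k by simp
        have "fps_nth (F * fps_of_poly s) k = (\<Sum>j<m. fps_nth F (i + j + Suc d) * vec_index v j)"
          unfolding i coeff[OF ds] by (intro sum.cong) (auto simp: cs)
        also have "\<dots> = 0" using v mult \<open>i < m\<close> by blast
        finally show ?thesis using False by (simp add: cr)
      qed (simp add: cr)
    qed
    ultimately show "\<exists>s r. pade m (m + d) F s r"
      using ds dr unfolding pade_def by blast
  next
    assume "\<exists>s r. pade m (m + d) F s r"
    then obtain s r where s: "s \<noteq> 0" "degree s < m" and r: "degree r < m + d"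
      and dvd: "fps_X ^ (m + (m + d)) dvd F * fps_of_poly s - fps_of_poly r"
      unfolding pade_def by blast
    define v where "v = vec m (\<lambda>j. coeff s (m - 1 - j))"
    have "vec_index v (m - 1 - degree s) = coeff s (degree s)"
      using s by (simp add: v_def)
    then have "v \<noteq> 0\<^sub>v m" using s by auto
    moreover have "v \<in> carrier_vec m" by (simp add: v_def)
    moreover have "(\<Sum>j<m. fps_nth F (i + j + Suc d) * vec_index v j) = 0" if "i < m" for i
    proof -
      have "(\<Sum>j<m. fps_nth F (i + j + Suc d) * vec_index v j) = fps_nth (F * fps_of_poly s) (m + d + i)"
        unfolding coeff[OF s(2)] by (intro sum.cong) (auto simp: v_def)
      also have "\<dots> = coeff r (m + d + i)"
        using dvd that unfolding fps_X_power_dvd_iff by (auto dest!: spec[of _ "m + d + i"])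
      also have "\<dots> = 0" using r by (simp add: coeff_eq_0)
      finally show ?thesis .
    qed
    ultimately show "hankel_det (Suc d) m (fps_nth F) = 0"
      unfolding hankel_det_def det_0_iff_vec_prod_zero_field[OF A] using mult by blast
  qed
qed

text \<open>This leads from the monic factors that occur in the analysis of roots to the
  denominators \<open>a - x\<close> and \<open>g - x\<close> of the Taylor expansions.\<close>

lemma pade_uminus:
  assumes "poly h 0 \<noteq> 0" "pade m K (Y / fps_of_poly h) s r"
  shows "pade m K (Y / fps_of_poly (- h)) s (- r)"
proof -
  have "Y / fps_of_poly (- h) = - (Y / fps_of_poly h)"
    using assms(1)
    by (simp add: fps_of_poly_uminus fps_divide_unit poly_0_coeff_0 fps_inverse_minus)
  moreover have "- F * S - - R = - (F * S - R)" for F S R :: "real fps"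
    by simp
  ultimately show ?thesis
    using assms(2) by (simp only: pade_def fps_of_poly_uminus degree_minus dvd_minus_iff) simp
qed

section \<open>Two by two matrices over a commutative ring\<close>

text \<open>With the size fixed by the type, matrices over polynomials and over power series form
  rings, and the ring laws apply to them directly.\<close>

datatype 'a mat2 = Mat2 (m11: 'a) (m12: 'a) (m21: 'a) (m22: 'a)

instantiation mat2 :: (comm_ring_1) ring_1
begin

definition "0 = Mat2 0 0 0 0"
definition "1 = Mat2 1 0 0 1"
definition "A + B = Mat2 (m11 A + m11 B) (m12 A + m12 B) (m21 A + m21 B) (m22 A + m22 B)"
definition "A - B = Mat2 (m11 A - m11 B) (m12 A - m12 B) (m21 A - m21 B) (m22 A - m22 B)"
definition "- A = Mat2 (- m11 A) (- m12 A) (- m21 A) (- m22 A)" for A :: "'a mat2"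
definition "A * B = Mat2
  (m11 A * m11 B + m12 A * m21 B) (m11 A * m12 B + m12 A * m22 B)
  (m21 A * m11 B + m22 A * m21 B) (m21 A * m12 B + m22 A * m22 B)"

lemmas mat2_defs = zero_mat2_def one_mat2_def plus_mat2_def minus_mat2_def uminus_mat2_def
  times_mat2_def

instance
  by standard (simp_all add: mat2_defs algebra_simps mat2.expand)

end

definition scal :: "'a::comm_ring_1 \<Rightarrow> 'a mat2" where
  "scal c = Mat2 c 0 0 c"

definition adj2 :: "'a::comm_ring_1 mat2 \<Rightarrow> 'a mat2" where
  "adj2 A = Mat2 (m22 A) (- m12 A) (- m21 A) (m11 A)"

definition det2 :: "'a::comm_ring_1 mat2 \<Rightarrow> 'a" where
  "det2 A = m11 A * m22 A - m12 A * m21 A"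

lemma scal_mult [simp]: "scal c * scal d = scal (c * d)"
  and scal_1 [simp]: "scal 1 = 1"
  and scal_add: "scal (c + d) = scal c + scal d"
  and scal_commute: "A * scal c = scal c * A"
  and scal_left_commute: "A * (scal c * B) = scal c * (A * B)"
  by (simp_all add: scal_def mat2_defs algebra_simps)

lemma scal_cancel: "scal c * A = scal c * B \<longleftrightarrow> A = B" if "c \<noteq> 0"
  for c :: "'a::idom"
  using that by (cases A; cases B) (simp add: scal_def mat2_defs)

lemma mat2_sel_simps [simp]:
  "m11 (A + B) = m11 A + m11 B" "m12 (A + B) = m12 A + m12 B"
  "m21 (A + B) = m21 A + m21 B" "m22 (A + B) = m22 A + m22 B"
  "m11 (A - B) = m11 A - m11 B" "m12 (A - B) = m12 A - m12 B"
  "m21 (A - B) = m21 A - m21 B" "m22 (A - B) = m22 A - m22 B"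
  "m11 (scal c * A) = c * m11 A" "m12 (scal c * A) = c * m12 A"
  "m21 (scal c * A) = c * m21 A" "m22 (scal c * A) = c * m22 A"
  "m11 (scal c) = c" "m12 (scal c) = 0" "m21 (scal c) = 0" "m22 (scal c) = c"
  "m11 (adj2 A) = m22 A" "m12 (adj2 A) = - m12 A"
  "m21 (adj2 A) = - m21 A" "m22 (adj2 A) = m11 A"
  by (simp_all add: mat2_defs scal_def adj2_def)

lemma mat2_mult_sel:
  "m11 (A * B) = m11 A * m11 B + m12 A * m21 B" "m12 (A * B) = m11 A * m12 B + m12 A * m22 B"
  "m21 (A * B) = m21 A * m11 B + m22 A * m21 B" "m22 (A * B) = m21 A * m12 B + m22 A * m22 B"
  by (simp_all add: times_mat2_def)

lemma adj2_mult: "adj2 (A * B) = adj2 B * adj2 A"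
  by (simp add: mat2_defs adj2_def algebra_simps)

lemma mult_adj2: "A * adj2 A = scal (det2 A)" and adj2_mult_self: "adj2 A * A = scal (det2 A)"
  by (simp_all add: mat2_defs adj2_def det2_def scal_def algebra_simps)

lemma det2_mult: "det2 (A * B) = det2 A * det2 B"
  by (simp add: mat2_defs det2_def algebra_simps)

lemma det2_1 [simp]: "det2 1 = 1"
  by (simp add: mat2_defs det2_def)

section \<open>Order of vanishing of a matrix, as entrywise divisibility\<close>

definition mdvd :: "'a::comm_ring_1 \<Rightarrow> 'a mat2 \<Rightarrow> bool" where
  "mdvd c A \<longleftrightarrow> c dvd m11 A \<and> c dvd m12 A \<and> c dvd m21 A \<and> c dvd m22 A"

lemma mdvd_iff: "mdvd c A \<longleftrightarrow> (\<exists>B. A = scal c * B)"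
proof
  assume "mdvd c A"
  then obtain p q r s where "m11 A = c * p" "m12 A = c * q" "m21 A = c * r" "m22 A = c * s"
    unfolding mdvd_def dvd_def by blast
  then have "A = scal c * Mat2 p q r s"
    by (simp add: mat2.expand)
  then show "\<exists>B. A = scal c * B" ..
qed (auto simp: mdvd_def)

lemma mdvd_mult: "mdvd c A \<Longrightarrow> mdvd d B \<Longrightarrow> mdvd (c * d) (A * B)"
  unfolding mdvd_iff by (metis mult.assoc scal_left_commute scal_mult)

lemma mdvd_mult_left: "mdvd c A \<Longrightarrow> mdvd c (B * A)"
  unfolding mdvd_iff by (metis scal_left_commute)

lemma mdvd_unit_cancel:
  assumes "is_unit d" "mdvd c (scal d * A)"
  shows "mdvd c A"
proof -
  from assms(1) obtain e where e: "1 = d * e" ..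
  have "c dvd z" if "c dvd d * z" for z
  proof -
    have "c dvd e * (d * z)" using that by (rule dvd_mult)
    also have "e * (d * z) = (d * e) * z" by (simp only: ac_simps)
    finally show ?thesis unfolding e[symmetric] by simp
  qed
  then show ?thesis using assms(2) unfolding mdvd_def mat2_sel_simps by blast
qed

lemma mdvd_adj2: "mdvd c A \<Longrightarrow> mdvd c (adj2 A)"
  by (simp add: mdvd_def)

lemma mdvd_diff: "mdvd c A \<Longrightarrow> mdvd c B \<Longrightarrow> mdvd c (A - B)"
  by (simp add: mdvd_def)

lemma mdvd_scal_mult: "mdvd c (scal d * A)" if "c dvd d"
  using that by (simp add: mdvd_def dvd_mult2)

lemma scal_scal_mult: "scal c * (scal d * A) = scal (c * d) * A"
  by (simp flip: mult.assoc)

lemma mat2_right_cancel: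
  fixes A B M :: "'a::idom mat2"
  assumes "A * M = B * M" "det2 M \<noteq> 0"
  shows "A = B"
proof -
  have "A * (M * adj2 M) = B * (M * adj2 M)"
    using assms(1) by (simp only: mult.assoc[symmetric])
  then show ?thesis
    using assms(2) by (simp add: mult_adj2 scal_commute scal_cancel)
qed

section \<open>From polynomial matrices to matrices of power series\<close>

abbreviation fps_mat :: "'a::comm_ring_1 poly mat2 \<Rightarrow> 'a fps mat2" where
  "fps_mat \<equiv> map_mat2 fps_of_poly"

lemma fps_mat_mult: "fps_mat (A * B) = fps_mat A * fps_mat B"
  and fps_mat_add: "fps_mat (A + B) = fps_mat A + fps_mat B"
  and fps_mat_adj2: "fps_mat (adj2 A) = adj2 (fps_mat A)"
  and fps_mat_scal: "fps_mat (scal p) = scal (fps_of_poly p)"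
  by (simp_all add: mat2_defs scal_def adj2_def mat2.map_sel fps_of_poly_add fps_of_poly_mult
      fps_of_poly_uminus)

lemma fps_X_power_dvd_fps_of_poly_iff:
  fixes p :: "real poly"
  shows "fps_X ^ n dvd fps_of_poly p \<longleftrightarrow> monom 1 n dvd p"
proof
  assume "fps_X ^ n dvd fps_of_poly p"
  then have "\<forall>k<n. coeff p k = 0" by (simp add: fps_X_power_dvd_iff)
  then show "monom 1 n dvd p" by (simp add: monom_1_dvd_iff')
next
  assume "monom 1 n dvd p"
  then show "fps_X ^ n dvd fps_of_poly p"
    using fps_of_poly_dvd fps_of_poly_monom' by metis
qed

lemma mdvd_fps_mat_iff: "mdvd (fps_X ^ n) (fps_mat A) \<longleftrightarrow> mdvd (monom 1 n) A"
  for A :: "real poly mat2"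
  by (simp add: mdvd_def mat2.map_sel fps_X_power_dvd_fps_of_poly_iff)

section \<open>The Lax pair of a billiard orbit\<close>

text \<open>The \<open>k\<close>-th segment starts at \<open>(x k, y k)\<close> and is traversed with velocity \<open>(u k, v k)\<close> in
  time \<open>t k\<close>; \<open>w k\<close> is the strength of the reflection at its end. The velocity is scaled so that its
  Minkowski square is 1 or -1; the sign is forced, since the segment is a chord of the ellipse that is
  tangent to the caustic.\<close>

locale billiard_orbit =
  fixes a b g :: real and x y u v t w :: "nat \<Rightarrow> real"
  assumes ab: "a > 0" "b > 0" and g: "g \<noteq> 0" "g \<noteq> a" "g \<noteq> - b"
    and on_ellipse: "b * (x k)\<^sup>2 + a * (y k)\<^sup>2 = a * b"
    and t_pos: "t k > 0" and w_nonzero: "w k \<noteq> 0"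
    and x_step: "x (Suc k) = x k + t k * u k" and y_step: "y (Suc k) = y k + t k * v k"
    and u_step: "u (Suc k) = u k + w k * x (Suc k) / a"
    and v_step: "v (Suc k) = v k - w k * y (Suc k) / b"
    and energy: "(u k)\<^sup>2 - (v k)\<^sup>2 = - sgn g"
    and caustic: "(b + g) * (u k)\<^sup>2 + (a - g) * (v k)\<^sup>2 = (x k * v k - y k * u k)\<^sup>2"
begin

text \<open>Up to the factor \<open>(a - z) * (b + z)\<close>, which clears denominators, \<open>alpha\<close>, \<open>beta\<close> and \<open>delta\<close> are
  \<open>Q(X, V)\<close>, \<open>Q(X, X) - 1\<close> and \<open>Q(V, V)\<close>, where \<open>X = (x, y)\<close>, \<open>V = (u, v)\<close> and \<open>Q\<close> is the
  bilinear form of the confocal conic with parameter \<open>z\<close>.\<close>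

definition alpha :: "nat \<Rightarrow> real poly" where
  "alpha k = [:b * x k * u k + a * y k * v k, x k * u k - y k * v k:]"

definition beta :: "nat \<Rightarrow> real poly" where
  "beta k = [:b * (x k)\<^sup>2 + a * (y k)\<^sup>2 - a * b, (x k)\<^sup>2 - (y k)\<^sup>2 - a + b, 1:]"

definition delta :: "nat \<Rightarrow> real poly" where
  "delta k = [:b * (u k)\<^sup>2 + a * (v k)\<^sup>2, (u k)\<^sup>2 - (v k)\<^sup>2:]"

definition lax :: "nat \<Rightarrow> real poly mat2" where
  "lax k = Mat2 (- alpha k) (beta k) (- delta k) (alpha k)"

text \<open>The free flight \<open>[1 t; 0 1]\<close> followed by the reflection
  \<open>[1 0; w/z 1]\<close>, multiplied by \<open>z\<close>. For \<open>z = a\<close> and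
  \<open>z = - b\<close> the quotient \<open>w/z\<close> is the coefficient in \<open>u_step\<close>
  and in \<open>v_step\<close>.\<close>

definition step_mat :: "nat \<Rightarrow> real poly mat2" where
  "step_mat k = Mat2 [:0, 1:] [:0, t k:] [:w k:] [:w k * t k, 1:]"

primrec monodromy :: "nat \<Rightarrow> real poly mat2" where
  "monodromy 0 = 1"
| "monodromy (Suc k) = step_mat k * monodromy k"

lemma lax_adj: "adj2 (fps_mat (lax k) + scal Y) = scal Y - fps_mat (lax k)"
  by (rule mat2.expand) (simp add: lax_def fps_of_poly_uminus mat2.map_sel)

text \<open>Up to cleared denominators this is the discriminant of the intersection of the segment's
  line with the conic of parameter \<open>z\<close>. Besides \<open>(a - z) * (b + z)\<close> it has
  one linear factor: its zero is the caustic, its leading coefficient the Minkowski square of the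
  velocity.\<close>

lemma alpha_beta_delta: "alpha k * alpha k - beta k * delta k = cubic a b g"
proof (rule poly_ext)
  fix z
  have "poly (alpha k * alpha k - beta k * delta k) z =
      (a - z) * (b + z) * (b * (u k)\<^sup>2 + a * (v k)\<^sup>2 - (x k * v k - y k * u k)\<^sup>2 + z * ((u k)\<^sup>2 - (v k)\<^sup>2))"
    unfolding alpha_def beta_def delta_def by (simp add: power2_eq_square algebra_simps)
  also have "b * (u k)\<^sup>2 + a * (v k)\<^sup>2 - (x k * v k - y k * u k)\<^sup>2 + z * ((u k)\<^sup>2 - (v k)\<^sup>2) =
      (z - g) * ((u k)\<^sup>2 - (v k)\<^sup>2)"
    using caustic[of k] by (simp add: algebra_simps)
  also have "(a - z) * (b + z) * ((z - g) * ((u k)\<^sup>2 - (v k)\<^sup>2)) = poly (cubic a b g) z"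
    unfolding energy cubic_def by (simp add: algebra_simps)
  finally show "poly (alpha k * alpha k - beta k * delta k) z = poly (cubic a b g) z" .
qed

lemma lax_square: "lax k * lax k = scal (cubic a b g)"
  using alpha_beta_delta[of k] by (simp add: lax_def scal_def mat2_defs algebra_simps)

text \<open>The flight intertwines the two Lax matrices identically. The reflection does so because
  the new vertex lies on the ellipse and the Minkowski square of the velocity is preserved.\<close>

lemma step_lax: "step_mat k * lax k = lax (Suc k) * step_mat k"
proof -
  define X Y where "X = x (Suc k) / a" and "Y = y (Suc k) / b"
  have x: "x (Suc k) = a * X" "x k = a * X - t k * u k" "u (Suc k) = u k + w k * X"
    and y: "y (Suc k) = b * Y" "y k = b * Y - t k * v k" "v (Suc k) = v k - w k * Y"
    using ab x_step[of k] y_step[of k] u_step[of k] v_step[of k] by (simp_all add: X_def Y_def)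
  have "a * b * (a * X\<^sup>2 + b * Y\<^sup>2) = a * b * 1"
    using on_ellipse[of "Suc k"] unfolding x y by (simp add: power2_eq_square algebra_simps)
  then have XY: "a * X\<^sup>2 + b * Y\<^sup>2 = 1"
    using ab by simp
  have "(u (Suc k))\<^sup>2 - (v (Suc k))\<^sup>2 = (u k)\<^sup>2 - (v k)\<^sup>2"
    by (simp add: energy)
  then have "w k * (2 * (u k * X + v k * Y) + w k * (X\<^sup>2 - Y\<^sup>2)) = 0"
    unfolding x y by (simp add: power2_eq_square algebra_simps)
  then have UV: "2 * (u k * X + v k * Y) + w k * (X\<^sup>2 - Y\<^sup>2) = 0"
    using w_nonzero[of k] by simp
  \<comment> \<open>Each entry of the difference of both sides is an explicit combination of
    \<open>P\<close> (vertex on the ellipse) and \<open>Q\<close> (preserved Minkowski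
    square).\<close>
  define P Q where "P = a * X\<^sup>2 + b * Y\<^sup>2 - 1"
    and "Q = 2 * (u k * X + v k * Y) + w k * (X\<^sup>2 - Y\<^sup>2)"
  have PQ: "P = 0" "Q = 0"
    using XY UV by (simp_all add: P_def Q_def)
  note defs = mat2_mult_sel step_mat_def lax_def alpha_def beta_def delta_def x y P_def Q_def
  have "poly (m11 (step_mat k * lax k)) z - poly (m11 (lax (Suc k) * step_mat k)) z =
      - (w k * (a - z) * (b + z)) * P" for z
    by (simp add: defs) (simp add: power2_eq_square algebra_simps)
  moreover have "poly (m12 (step_mat k * lax k)) z - poly (m12 (lax (Suc k) * step_mat k)) z =
      - (t k * w k * (a - z) * (b + z)) * P" for z
    by (simp add: defs) (simp add: power2_eq_square algebra_simps)
  moreover have "poly (m21 (step_mat k * lax k)) z - poly (m21 (lax (Suc k) * step_mat k)) z =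
      - (w k * (a - z) * (b + z)) * Q" for z
    by (simp add: defs) (simp add: power2_eq_square algebra_simps)
  moreover have "poly (m22 (step_mat k * lax k)) z - poly (m22 (lax (Suc k) * step_mat k)) z =
      (w k * (a - z) * (b + z)) * (P - t k * Q)" for z
    by (simp add: defs) (simp add: power2_eq_square algebra_simps)
  ultimately show ?thesis
    unfolding PQ by (intro mat2.expand conjI poly_ext) simp_all
qed

section \<open>Determinant, special values and degrees of the monodromy\<close>

lemma det_step: "det2 (step_mat k) = monom 1 2"
  by (simp add: step_mat_def det2_def monom_altdef power2_eq_square)

lemma monodromy_lax: "monodromy n * lax 0 = lax n * monodromy n"
proof (induction n)
  case (Suc n)
  have "monodromy (Suc n) * lax 0 = (step_mat n * lax n) * monodromy n"
    by (simp add: Suc mult.assoc)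
  then show ?case by (simp add: step_lax mult.assoc)
qed simp

lemma det_monodromy: "det2 (monodromy n) = monom 1 (2 * n)"
  by (induction n) (simp_all add: det2_mult det_step mult_monom)

lemma monodromy_at_a:
  "poly (m11 (monodromy n)) a * x 0 + poly (m12 (monodromy n)) a * u 0 = a ^ n * x n"
  "poly (m21 (monodromy n)) a * x 0 + poly (m22 (monodromy n)) a * u 0 = a ^ n * u n"
proof (induction n)
  case (Suc n)
  {
    case 1
    have "poly (m11 (monodromy (Suc n))) a * x 0 + poly (m12 (monodromy (Suc n))) a * u 0 =
      a * (poly (m11 (monodromy n)) a * x 0 + poly (m12 (monodromy n)) a * u 0) +
      a * t n * (poly (m21 (monodromy n)) a * x 0 + poly (m22 (monodromy n)) a * u 0)"
      by (simp add: mat2_mult_sel step_mat_def algebra_simps)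
    then show ?case unfolding Suc.IH by (simp add: x_step algebra_simps)
  next
    case 2
    have "poly (m21 (monodromy (Suc n))) a * x 0 + poly (m22 (monodromy (Suc n))) a * u 0 =
      w n * (poly (m11 (monodromy n)) a * x 0 + poly (m12 (monodromy n)) a * u 0) +
      (w n * t n + a) * (poly (m21 (monodromy n)) a * x 0 + poly (m22 (monodromy n)) a * u 0)"
      by (simp add: mat2_mult_sel step_mat_def algebra_simps)
    also have "\<dots> = a ^ Suc n * u (Suc n)"
      unfolding Suc.IH using ab by (simp add: u_step x_step algebra_simps)
    finally show ?case .
  }
qed (simp_all add: one_mat2_def)

lemma monodromy_at_b:
  "poly (m11 (monodromy n)) (- b) * y 0 + poly (m12 (monodromy n)) (- b) * v 0 = (- b) ^ n * y n"
  "poly (m21 (monodromy n)) (- b) * y 0 + poly (m22 (monodromy n)) (- b) * v 0 = (- b) ^ n * v n"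
proof (induction n)
  case (Suc n)
  {
    case 1
    have "poly (m11 (monodromy (Suc n))) (- b) * y 0 + poly (m12 (monodromy (Suc n))) (- b) * v 0 =
      (- b) * (poly (m11 (monodromy n)) (- b) * y 0 + poly (m12 (monodromy n)) (- b) * v 0) +
      (- b) * t n * (poly (m21 (monodromy n)) (- b) * y 0 + poly (m22 (monodromy n)) (- b) * v 0)"
      by (simp add: mat2_mult_sel step_mat_def algebra_simps)
    then show ?case unfolding Suc.IH by (simp add: y_step algebra_simps)
  next
    case 2
    have "poly (m21 (monodromy (Suc n))) (- b) * y 0 + poly (m22 (monodromy (Suc n))) (- b) * v 0 =
      w n * (poly (m11 (monodromy n)) (- b) * y 0 + poly (m12 (monodromy n)) (- b) * v 0) +
      (w n * t n - b) * (poly (m21 (monodromy n)) (- b) * y 0 + poly (m22 (monodromy n)) (- b) * v 0)"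
      by (simp add: mat2_mult_sel step_mat_def algebra_simps)
    also have "\<dots> = (- b) ^ Suc n * v (Suc n)"
      unfolding Suc.IH using ab by (simp add: v_step y_step algebra_simps)
    finally show ?case .
  }
qed (simp_all add: one_mat2_def)

text \<open>The coefficient of \<open>z\<close> in a step matrix is \<open>[1 t; 0 1]\<close>, so
  the coefficient of \<open>z^n\<close> in the product is upper unitriangular as well.\<close>

lemma monodromy_coeff_above:
  "k > n \<Longrightarrow> coeff (m11 (monodromy n)) k = 0" "k > n \<Longrightarrow> coeff (m12 (monodromy n)) k = 0"
  "k \<ge> n \<Longrightarrow> coeff (m21 (monodromy n)) k = 0" "k > n \<Longrightarrow> coeff (m22 (monodromy n)) k = 0"
  by (induction n arbitrary: k)
     (auto simp: one_mat2_def mat2_mult_sel step_mat_def coeff_pCons split: nat.splits)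

lemma monodromy_degree:
  "degree (m11 (monodromy n)) \<le> n" "degree (m12 (monodromy n)) \<le> n" "degree (m22 (monodromy n)) \<le> n"
  "n > 0 \<Longrightarrow> degree (m21 (monodromy n)) \<le> n - 1"
  using monodromy_coeff_above by (auto intro!: degree_le)

lemma monodromy_lead: "coeff (m11 (monodromy n)) n = 1" "coeff (m22 (monodromy n)) n = 1"
proof (induction n)
  case (Suc n)
  {
    case 1
    show ?case using Suc.IH monodromy_coeff_above[of n n]
      by (simp add: mat2_mult_sel step_mat_def)
  next
    case 2
    show ?case using Suc.IH monodromy_coeff_above[of n "Suc n"]
      by (simp add: mat2_mult_sel step_mat_def)
  }
qed (simp_all add: one_mat2_def)

text \<open>At 0 a step matrix is \<open>[0 0; w, w t]\<close>. In a product the first row stays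
  zero and the lower right entries \<open>w t\<close>, none of them zero, multiply.\<close>

lemma monodromy_at_0:
  assumes "n > 0"
  shows "poly (m11 (monodromy n)) 0 = 0" "poly (m12 (monodromy n)) 0 = 0" "poly (m22 (monodromy n)) 0 \<noteq> 0"
proof -
  have "poly (m11 (monodromy n)) 0 = 0 \<and> poly (m12 (monodromy n)) 0 = 0 \<and> poly (m22 (monodromy n)) 0 \<noteq> 0"
    using assms
  proof (induction rule: nat_induct_non_zero)
    case (Suc n)
    then show ?case using t_pos[of n] w_nonzero[of n] by (simp add: mat2_mult_sel step_mat_def)
  qed (use t_pos[of 0] w_nonzero[of 0] in \<open>simp add: mat2_mult_sel step_mat_def one_mat2_def\<close>)
  then show "poly (m11 (monodromy n)) 0 = 0" "poly (m12 (monodromy n)) 0 = 0" "poly (m22 (monodromy n)) 0 \<noteq> 0"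
    by auto
qed

lemma speed_pos: "b * (u k)\<^sup>2 + a * (v k)\<^sup>2 > 0"
proof -
  have "u k \<noteq> 0 \<or> v k \<noteq> 0" using energy[of k] g by (auto simp: sgn_if split: if_splits)
  then show ?thesis using ab by (auto intro: add_pos_nonneg add_nonneg_pos)
qed

text \<open>Subtracting the ellipse equations of both ends and cancelling the flight time gives the
  chord equation. The resulting sign later selects the square root of the cubic.\<close>

lemma inward:
  "2 * (b * x k * u k + a * y k * v k) + t k * (b * (u k)\<^sup>2 + a * (v k)\<^sup>2) = 0"
  "b * x k * u k + a * y k * v k < 0"
proof -
  have "t k * (2 * (b * x k * u k + a * y k * v k) + t k * (b * (u k)\<^sup>2 + a * (v k)\<^sup>2)) = 0"
    using on_ellipse[of k] on_ellipse[of "Suc k"] unfolding x_step y_step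
    by (simp add: power2_eq_square algebra_simps)
  then show *: "2 * (b * x k * u k + a * y k * v k) + t k * (b * (u k)\<^sup>2 + a * (v k)\<^sup>2) = 0"
    using t_pos[of k] by simp
  have "t k * (b * (u k)\<^sup>2 + a * (v k)\<^sup>2) > 0"
    using t_pos[of k] speed_pos[of k] by simp
  moreover have "A < 0" if "2 * A + B = 0" "B > 0" for A B :: real
    using that by linarith
  ultimately show "b * x k * u k + a * y k * v k < 0" using * by blast
qed

end

section \<open>Kernel of the monodromy at 0\<close>

locale billiard_orbit_root = billiard_orbit +
  fixes Y :: "real fps"
  assumes Y_square: "Y * Y = fps_of_poly (cubic a b g)" and Y_pos: "fps_nth Y 0 > 0"
begin

text \<open>\<open>beta k\<close> vanishes at 0 because the vertex lies on the table, so
  \<open>alpha k\<close> and \<open>Y\<close> agree there up to sign. Inward velocity gives the same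
  sign for every \<open>k\<close>.\<close>

lemma Y_nth_0: "fps_nth Y 0 = - coeff (alpha k) 0"
proof -
  have "(fps_nth Y 0)\<^sup>2 = fps_nth (Y * Y) 0" by (simp add: power2_eq_square)
  also have "\<dots> = coeff (alpha k * alpha k - beta k * delta k) 0"
    by (simp add: Y_square alpha_beta_delta)
  also have "\<dots> = (- coeff (alpha k) 0)\<^sup>2"
    using on_ellipse[of k] by (simp add: beta_def coeff_mult_0 power2_eq_square)
  finally show ?thesis
    using Y_pos inward(2)[of k] by (simp add: power2_eq_iff alpha_def)
qed

text \<open>The Lax matrix has eigenvalues \<open>Y\<close> and \<open>- Y\<close>, so its sum with
  \<open>Y\<close> is \<open>2 * Y\<close> times the projection onto the first eigenspace.\<close>

lemma lax_Y: "(fps_mat (lax k) + scal Y) * (fps_mat (lax k) + scal Y) =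
    scal (2 * Y) * (fps_mat (lax k) + scal Y)"
  "(fps_mat (lax k) - scal Y) * (fps_mat (lax k) + scal Y) = 0"
proof -
  let ?L = "fps_mat (lax k)"
  have LL: "?L * ?L = scal (Y * Y)"
    unfolding fps_mat_mult[symmetric] lax_square fps_mat_scal Y_square ..
  have two: "scal (2 * Y) = scal Y + scal Y"
    by (simp only: mult_2 scal_add)
  show "(?L + scal Y) * (?L + scal Y) = scal (2 * Y) * (?L + scal Y)"
    unfolding two distrib_left distrib_right scal_commute[of ?L] LL scal_mult
    by (simp only: add_ac)
  show "(?L - scal Y) * (?L + scal Y) = 0"
    unfolding distrib_left left_diff_distrib scal_commute[of ?L] LL scal_mult by simp
qed

text \<open>The determinant \<open>z^2\<close> of a step is spent entirely on the
  \<open>Y\<close>-eigenvector. The first row has a visible factor \<open>z\<close>; the second one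
  comes from the chord equation and the value of \<open>Y\<close> at 0.\<close>

lemma mdvd_step: "mdvd (fps_X ^ 2) (fps_mat (step_mat k) * (fps_mat (lax k) + scal Y))"
proof -
  let ?E = "fps_mat (step_mat k) * (fps_mat (lax k) + scal Y)" and ?L = "fps_mat (lax (Suc k))"
  define e1 e2 where "e1 = Y - fps_of_poly (alpha k) - fps_const (t k) * fps_of_poly (delta k)"
    and "e2 = fps_of_poly (beta k) + fps_const (t k) * (fps_of_poly (alpha k) + Y)"
  have E: "m11 ?E = fps_X * e1" "m12 ?E = fps_X * e2"
    by (simp_all add: mat2_mult_sel mat2.map_sel step_mat_def lax_def e1_def e2_def
        fps_of_poly_pCons fps_of_poly_uminus algebra_simps)
  have "fps_nth e1 0 = - (2 * (b * x k * u k + a * y k * v k) + t k * (b * (u k)\<^sup>2 + a * (v k)\<^sup>2))"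
    by (simp add: e1_def Y_nth_0[of k] alpha_def delta_def)
  then have "fps_nth e1 0 = 0"
    using inward(1)[of k] by simp
  moreover have "fps_nth e2 0 = 0"
    using on_ellipse[of k] by (simp add: e2_def Y_nth_0[of k] alpha_def beta_def)
  ultimately have "fps_X dvd e1" "fps_X dvd e2"
    using fps_X_power_dvd_iff[of 1] by auto
  then have row1: "fps_X ^ 2 dvd m11 ?E" "fps_X ^ 2 dvd m12 ?E"
    unfolding E power2_eq_square by (simp_all add: mult_dvd_mono)
  \<comment> \<open>The columns of \<open>?E\<close> are eigenvectors of the next Lax matrix. Since
    \<open>alpha (Suc k) - Y\<close> is a unit, the second row inherits the divisibility of the
    first.\<close>
  have "fps_mat (step_mat k) * fps_mat (lax k) = ?L * fps_mat (step_mat k)"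
    unfolding fps_mat_mult[symmetric] step_lax ..
  then have "(?L - scal Y) * ?E = fps_mat (step_mat k) * ((fps_mat (lax k) - scal Y) * (fps_mat (lax k) + scal Y))"
    unfolding left_diff_distrib right_diff_distrib
    by (simp only: mult.assoc[symmetric] scal_commute)
  then have "(?L - scal Y) * ?E = 0"
    by (simp add: lax_Y)
  moreover have "m21 ((?L - scal Y) * ?E) = 
      (fps_of_poly (alpha (Suc k)) - Y) * m21 ?E - fps_of_poly (delta (Suc k)) * m11 ?E"
    "m22 ((?L - scal Y) * ?E) = 
      (fps_of_poly (alpha (Suc k)) - Y) * m22 ?E - fps_of_poly (delta (Suc k)) * m12 ?E"
    by (simp_all only: mat2_mult_sel) (simp_all add: lax_def mat2.map_sel fps_of_poly_uminus)
  ultimately have eq: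
    "(fps_of_poly (alpha (Suc k)) - Y) * m21 ?E = fps_of_poly (delta (Suc k)) * m11 ?E"
    "(fps_of_poly (alpha (Suc k)) - Y) * m22 ?E = fps_of_poly (delta (Suc k)) * m12 ?E"
    by (simp_all add: zero_mat2_def)
  have "is_unit (fps_of_poly (alpha (Suc k)) - Y)"
    using Y_pos by (simp add: fps_is_unit_iff Y_nth_0[of "Suc k"])
  then have "fps_X ^ 2 dvd m21 ?E" "fps_X ^ 2 dvd m22 ?E"
    using row1 eq by (metis dvd_mult dvd_mult_unit_iff')+
  then show ?thesis
    using row1 by (simp add: mdvd_def)
qed

lemma mdvd_monodromy: "mdvd (fps_X ^ (2 * n)) (fps_mat (monodromy n) * (fps_mat (lax 0) + scal Y))"
proof (induction n)
  case 0
  show ?case by (simp add: mdvd_def)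
next
  case (Suc n)
  let ?M = "fps_mat (monodromy n)" and ?L = "fps_mat (lax 0) + scal Y"
    and ?A = "fps_mat (step_mat n)" and ?L' = "fps_mat (lax n) + scal Y"
  have comm: "?M * ?L = ?L' * ?M"
    unfolding distrib_left distrib_right fps_mat_mult[symmetric] monodromy_lax scal_commute ..
  \<comment> \<open>Multiplying by the unit \<open>2 * Y\<close> doubles the factor
    \<open>?L\<close>: one copy moves through \<open>?M\<close> to the new step, the other stays for
    the induction hypothesis.\<close>
  have "scal (2 * Y) * (fps_mat (monodromy (Suc n)) * ?L) = ?A * (?M * (?L * ?L))"
    by (simp only: monodromy.simps fps_mat_mult mult.assoc lax_Y(1) scal_left_commute)
  also have "\<dots> = ?A * ((?M * ?L) * ?L)"
    by (simp only: mult.assoc)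
  also have "\<dots> = ?A * ((?L' * ?M) * ?L)"
    by (simp only: comm)
  also have "\<dots> = (?A * ?L') * (?M * ?L)"
    by (simp only: mult.assoc)
  also have "mdvd (fps_X ^ 2 * fps_X ^ (2 * n)) \<dots>"
    by (intro mdvd_mult mdvd_step Suc.IH)
  finally have "mdvd (fps_X ^ (2 * Suc n)) (scal (2 * Y) * (fps_mat (monodromy (Suc n)) * ?L))"
    by (simp add: power_add power2_eq_square mult_ac)
  moreover have "is_unit (2 * Y)"
    using Y_pos by (simp add: fps_is_unit_iff)
  ultimately show ?case
    by (rule mdvd_unit_cancel[rotated])
qed

end

section \<open>From Pade approximants to symmetric orbits\<close>

context billiard_orbit
begin

text \<open>At \<open>z = a\<close> the terms in \<open>y\<close> and \<open>v\<close> cancel, and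
  the matrix is \<open>a + b\<close> times \<open>[- x u, x^2; - u^2, x u]\<close>, which kills
  \<open>(x, u)\<close>.\<close>

lemma lax_at_a:
  "poly (m11 (lax k)) a * x k + poly (m12 (lax k)) a * u k = 0"
  "poly (m21 (lax k)) a * x k + poly (m22 (lax k)) a * u k = 0"
  by (simp_all add: lax_def alpha_def beta_def delta_def power2_eq_square algebra_simps)

lemma lax_at_b:
  "poly (m11 (lax k)) (- b) * y k + poly (m12 (lax k)) (- b) * v k = 0"
  "poly (m21 (lax k)) (- b) * y k + poly (m22 (lax k)) (- b) * v k = 0"
  by (simp_all add: lax_def alpha_def beta_def delta_def power2_eq_square algebra_simps)

text \<open>A polynomial matrix that commutes with the Lax matrix and has the kernel of the monodromy
  at \<open>0\<close> to the full order is a constant multiple of the monodromy: the quotient has degree 0, it is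
  triangular, and it conjugates the Lax matrices at the two ends of the orbit.\<close>

lemma commuting_matrix_eq_monodromy:
  assumes n: "n > 0"
    and N: "N = scal p + scal q * lax 0"
    and div: "mdvd (monom 1 (2 * n)) (N * adj2 (monodromy n))"
    and deg_p: "degree p \<le> n" and deg_q: "degree q + 2 \<le> n"
  shows "N = scal [:coeff p n:] * monodromy n"
proof -
  let ?M = "monodromy n" and ?z = "monom (1::real) (2 * n)"
  \<comment> \<open>\<open>G\<close> is \<open>N\<close> times the inverse of the monodromy; the
    assumed divisibility makes it polynomial.\<close>
  obtain G where G: "N * adj2 ?M = scal ?z * G"
    using div unfolding mdvd_iff by blast
  have "scal ?z * N = N * (adj2 ?M * ?M)"
    by (simp add: adj2_mult_self det_monodromy scal_commute)
  also have "\<dots> = scal ?z * (G * ?M)"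
    by (simp only: mult.assoc[symmetric] G)
  finally have NGM: "N = G * ?M"
    by (simp add: scal_cancel)
  have deg_lax: "degree (m11 (lax 0)) \<le> 1" "degree (m12 (lax 0)) \<le> 2"
    "degree (m21 (lax 0)) \<le> 1" "degree (m22 (lax 0)) \<le> 1"
    by (auto simp: lax_def alpha_def beta_def delta_def intro!: degree_le split: nat.split
        simp: coeff_pCons)
  have deg_q_lax: "degree (q * l) \<le> n - 2 + d" if "degree l \<le> d" for l d
    using degree_mult_le[of q l] that deg_q by linarith
  have N_sel: "m11 N = p + q * m11 (lax 0)" "m12 N = q * m12 (lax 0)"
    "m21 N = q * m21 (lax 0)" "m22 N = p + q * m22 (lax 0)"
    by (simp_all add: N)
  have deg_N: "degree (m11 N) \<le> n" "degree (m12 N) \<le> n"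
    "degree (m21 N) \<le> n - 1" "degree (m22 N) \<le> n"
    unfolding N_sel
    using deg_q_lax[OF deg_lax(1)] deg_q_lax[OF deg_lax(2)] deg_q_lax[OF deg_lax(3)]
      deg_q_lax[OF deg_lax(4)] deg_p deg_q
    by (auto intro!: degree_add_le)
  have deg_prod: "degree (r * s) \<le> i + j" if "degree r \<le> i" "degree s \<le> j" for r s :: "real poly" and i j
    using degree_mult_le[of r s] that by linarith
  have G_sel: "?z * m11 G = m11 N * m22 ?M - m12 N * m21 ?M"
    "?z * m12 G = m12 N * m11 ?M - m11 N * m12 ?M"
    "?z * m21 G = m21 N * m22 ?M - m22 N * m21 ?M"
    "?z * m22 G = m22 N * m11 ?M - m21 N * m12 ?M"
    using arg_cong[OF G, of m11] arg_cong[OF G, of m12] arg_cong[OF G, of m21] arg_cong[OF G, of m22]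
    by (simp_all add: mat2_mult_sel)
  have const: "P = [:coeff P 0:]" if "degree (?z * P) \<le> 2 * n" for P
  proof (cases "P = 0")
    case False
    then have "degree (?z * P) = 2 * n + degree P"
      by (simp add: degree_mult_eq degree_monom_eq)
    then have "degree P = 0" using that by simp
    then show ?thesis by (metis degree_eq_zeroE coeff_pCons_0)
  qed simp
  note dM = monodromy_degree[of n] monodromy_degree(4)[OF n]
  obtain g1 e g2 where G_eq: "m11 G = [:g1:]" "m12 G = [:e:]" "m22 G = [:g2:]"
  proof
    show "m11 G = [:coeff (m11 G) 0:]"
      using deg_prod[OF deg_N(1) dM(3)] deg_prod[OF deg_N(2) dM(5)]
      by (intro const) (auto simp: G_sel intro!: degree_diff_le)
    show "m12 G = [:coeff (m12 G) 0:]"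
      using deg_prod[OF deg_N(2) dM(1)] deg_prod[OF deg_N(1) dM(2)]
      by (intro const) (auto simp: G_sel intro!: degree_diff_le)
    show "m22 G = [:coeff (m22 G) 0:]"
      using deg_prod[OF deg_N(4) dM(1)] deg_prod[OF deg_N(3) dM(2)]
      by (intro const) (auto simp: G_sel intro!: degree_diff_le)
  qed
  \<comment> \<open>Both lower left entries have degree at most \<open>n - 1\<close>, so this entry
    of \<open>?z * G\<close> falls short of degree \<open>2 * n\<close>.\<close>
  have G21: "m21 G = 0"
  proof (rule ccontr)
    assume "m21 G \<noteq> 0"
    then have "degree (?z * m21 G) = 2 * n + degree (m21 G)"
      by (simp add: degree_mult_eq degree_monom_eq)
    moreover have "degree (?z * m21 G) \<le> 2 * n - 1"
      using deg_prod[OF deg_N(3) dM(3)] deg_prod[OF deg_N(4) dM(5)] n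
      by (auto simp: G_sel intro!: degree_diff_le)
    ultimately show False using n by simp
  qed
  have "(G * lax n) * ?M = G * (?M * lax 0)"
    by (simp add: monodromy_lax mult.assoc)
  also have "\<dots> = N * lax 0"
    by (simp add: NGM mult.assoc)
  also have "\<dots> = lax 0 * N"
    unfolding N distrib_left distrib_right
    by (simp add: scal_commute scal_left_commute mult.assoc)
  also have "\<dots> = (lax 0 * G) * ?M"
    by (simp add: NGM mult.assoc)
  finally have GL: "G * lax n = lax 0 * G"
    by (rule mat2_right_cancel) (simp add: det_monodromy)
  have "m21 (G * lax n) = - smult g2 (delta n)" "m21 (lax 0 * G) = - smult g1 (delta 0)"
    "m12 (G * lax n) = smult g1 (beta n) + smult e (alpha n)"
    "m12 (lax 0 * G) = smult g2 (beta 0) - smult e (alpha 0)"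
    by (simp_all add: mat2_mult_sel G_eq G21 lax_def)
  then have "smult g2 (delta n) = smult g1 (delta 0)"
    and e: "smult g1 (beta n) + smult e (alpha n) = smult g2 (beta 0) - smult e (alpha 0)"
    using GL by auto
  \<comment> \<open>The leading coefficient of \<open>delta\<close> is the Minkowski square of the
    velocity, the same at both ends. This equates the diagonal entries.\<close>
  then have "coeff (smult g2 (delta n)) 1 = coeff (smult g1 (delta 0)) 1"
    by simp
  then have g12: "g1 = g2"
    using g by (simp add: delta_def energy sgn_zero_iff)
  \<comment> \<open>At \<open>z = 0\<close> the \<open>beta\<close> terms drop out, and both
    \<open>alpha\<close> terms are negative, so the off-diagonal entry \<open>e\<close> must
    vanish.\<close>
  have "coeff (beta k) 0 = 0" for k
    using on_ellipse[of k] by (simp add: beta_def)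
  then have "e * (coeff (alpha n) 0 + coeff (alpha 0) 0) = 0"
    using arg_cong[OF e, of "\<lambda>P. coeff P 0"] by (simp add: algebra_simps)
  moreover have "coeff (alpha n) 0 + coeff (alpha 0) 0 < 0"
    using inward(2)[of n] inward(2)[of 0] by (simp add: alpha_def)
  ultimately have "e = 0" by auto
  then have "G = scal [:g1:]"
    using G_eq G21 g12 by (intro mat2.expand) simp
  then have NM: "N = scal [:g1:] * ?M"
    using NGM by simp
  then have "g1 = coeff (m22 N) n"
    by (simp add: monodromy_lead)
  also have "\<dots> = coeff p n"
    using deg_q_lax[OF deg_lax(4)] deg_q by (simp add: N_sel coeff_eq_0)
  finally show ?thesis using NM by simp
qed

text \<open>At \<open>a\<close> and \<open>- b\<close> the Lax matrix kills the phase vector, on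
  which \<open>p + q * lax 0\<close> thus acts as the number \<open>p\<close>.\<close>

lemma monodromy_eigenvalue:
  assumes N: "scal p + scal q * lax 0 = scal [:d:] * monodromy n"
  shows "poly p a * x 0 = d * a ^ n * x n" "poly p a * u 0 = d * a ^ n * u n"
    "poly p (- b) * y 0 = d * (- b) ^ n * y n" "poly p (- b) * v 0 = d * (- b) ^ n * v n"
proof -
  have *: "p + q * m11 (lax 0) = smult d (m11 (monodromy n))" "q * m12 (lax 0) = smult d (m12 (monodromy n))"
    "q * m21 (lax 0) = smult d (m21 (monodromy n))" "p + q * m22 (lax 0) = smult d (m22 (monodromy n))"
    using arg_cong[OF N, of m11] arg_cong[OF N, of m12] arg_cong[OF N, of m21] arg_cong[OF N, of m22]
    by simp_all
  have ev: "poly p z * \<xi> = d * \<xi>'" "poly p z * \<eta> = d * \<eta>'"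
    if "poly (m11 (lax 0)) z * \<xi> + poly (m12 (lax 0)) z * \<eta> = 0"
      "poly (m21 (lax 0)) z * \<xi> + poly (m22 (lax 0)) z * \<eta> = 0"
      "poly (m11 (monodromy n)) z * \<xi> + poly (m12 (monodromy n)) z * \<eta> = \<xi>'"
      "poly (m21 (monodromy n)) z * \<xi> + poly (m22 (monodromy n)) z * \<eta> = \<eta>'" for z \<xi> \<eta> \<xi>' \<eta>'
  proof -
    have e: "poly p z + poly q z * poly (m11 (lax 0)) z = d * poly (m11 (monodromy n)) z"
      "poly q z * poly (m12 (lax 0)) z = d * poly (m12 (monodromy n)) z"
      "poly q z * poly (m21 (lax 0)) z = d * poly (m21 (monodromy n)) z"
      "poly p z + poly q z * poly (m22 (lax 0)) z = d * poly (m22 (monodromy n)) z"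
      using arg_cong[OF *(1), of "\<lambda>P. poly P z"] arg_cong[OF *(2), of "\<lambda>P. poly P z"]
        arg_cong[OF *(3), of "\<lambda>P. poly P z"] arg_cong[OF *(4), of "\<lambda>P. poly P z"] by simp_all
    have "d * \<xi>' = (poly p z + poly q z * poly (m11 (lax 0)) z) * \<xi> + (poly q z * poly (m12 (lax 0)) z) * \<eta>"
      unfolding e that(3)[symmetric] by (simp add: algebra_simps)
    also have "\<dots> = poly p z * \<xi> + poly q z * (poly (m11 (lax 0)) z * \<xi> + poly (m12 (lax 0)) z * \<eta>)"
      by (simp add: algebra_simps)
    finally show "poly p z * \<xi> = d * \<xi>'" unfolding that(1) by simp
    have "d * \<eta>' = (poly q z * poly (m21 (lax 0)) z) * \<xi> + (poly p z + poly q z * poly (m22 (lax 0)) z) * \<eta>"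
      unfolding e that(4)[symmetric] by (simp add: algebra_simps)
    also have "\<dots> = poly p z * \<eta> + poly q z * (poly (m21 (lax 0)) z * \<xi> + poly (m22 (lax 0)) z * \<eta>)"
      by (simp add: algebra_simps)
    finally show "poly p z * \<eta> = d * \<eta>'" unfolding that(2) by simp
  qed
  show "poly p a * x 0 = d * a ^ n * x n" "poly p a * u 0 = d * a ^ n * u n"
    using ev[OF lax_at_a[of 0] monodromy_at_a[of n]] by simp_all
  show "poly p (- b) * y 0 = d * (- b) ^ n * y n" "poly p (- b) * v 0 = d * (- b) ^ n * v n"
    using ev[OF lax_at_b[of 0] monodromy_at_b[of n]] by simp_all
qed

end

context billiard_orbit_root
begin

lemma root_quotient:
  assumes "h * h' = cubic a b g" "poly h 0 \<noteq> 0"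
  defines "F \<equiv> Y / fps_of_poly h"
  shows "fps_of_poly h * F = Y" "fps_of_poly h * (F * F) = fps_of_poly h'"
proof -
  let ?H = "fps_of_poly h"
  have H: "is_unit ?H"
    using assms(2) by (simp add: fps_is_unit_iff poly_0_coeff_0)
  then show FH: "?H * F = Y"
    by (simp add: F_def)
  have "?H * (?H * (F * F)) = ?H * fps_of_poly h'"
    using Y_square by (simp add: FH[symmetric] assms(1)[symmetric] fps_of_poly_mult ac_simps)
  moreover have "?H \<noteq> 0" using H by auto
  ultimately show "?H * (F * F) = fps_of_poly h'"
    using mult_left_cancel by blast
qed

text \<open>\<open>K = m\<close> is the case of even \<open>n\<close>, \<open>K = Suc m\<close> that
  of odd \<open>n\<close>. The approximant yields \<open>p\<close> and \<open>q\<close> by squaring;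
  the signs come from comparing \<open>p\<close> at the roots of the cubic with its leading
  coefficient.\<close>

lemma pade_imp_symmetry:
  fixes h h' s r :: "real poly"
  assumes h: "degree h = 1" "h * h' = cubic a b g" "poly h 0 \<noteq> 0"
    and pade: "pade m K (Y / fps_of_poly h) s r"
    and K: "K = m \<or> K = Suc m" and n: "n = m + K" "n \<ge> 2"
  defines "\<tau> \<equiv> \<lambda>z. if (poly h z = 0) = (K = m) then 1 else -1 :: real"
  shows "x n = \<tau> a * x 0" "u n = \<tau> a * u 0" "y n = \<tau> (- b) * y 0" "v n = \<tau> (- b) * v 0"
proof -
  define F where "F = Y / fps_of_poly h"
  let ?H = "fps_of_poly h" and ?S = "fps_of_poly s" and ?R = "fps_of_poly r"
  have s: "s \<noteq> 0" "degree s < m" and r: "degree r < K"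
    and dvd: "fps_X ^ n dvd F * ?S - ?R"
    using pade by (auto simp: pade_def F_def n)
  have FH: "?H * F = Y" and HFF: "?H * (F * F) = fps_of_poly h'"
    using root_quotient[OF h(2,3)] by (simp_all add: F_def)
  have "h \<noteq> 0" "h' \<noteq> 0" using h(2) cubic_neq_0[OF g(1)] by auto
  have "degree h' = 2"
    using degree_mult_eq[OF \<open>h \<noteq> 0\<close> \<open>h' \<noteq> 0\<close>] degree_cubic[OF g(1)] h by simp
  define P1 P2 where "P1 = h' * (s * s)" and "P2 = h * (r * r)"
  have deg1: "degree P1 = 2 + 2 * degree s"
    using s \<open>h' \<noteq> 0\<close> \<open>degree h' = 2\<close> by (simp add: P1_def degree_mult_eq)
  have deg2: "degree P2 = (if r = 0 then 0 else 1 + 2 * degree r)"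
    using h \<open>h \<noteq> 0\<close> by (simp add: P2_def degree_mult_eq)
  have deg: "degree P1 \<le> n" "degree P2 \<le> n"
    using deg1 deg2 s r K n by (auto split: if_splits)
  \<comment> \<open>\<open>\<Delta>\<close> is divisible by \<open>z^n\<close> and has degree at
    most \<open>n\<close>. It is nonzero because \<open>P1\<close> has even degree and a nonzero
    \<open>P2\<close> odd degree.\<close>
  define \<Delta> where "\<Delta> = P1 - P2"
  have "fps_of_poly \<Delta> = ?H * (F * ?S + ?R) * (F * ?S - ?R)"
    by (simp add: \<Delta>_def P1_def P2_def fps_of_poly_simps HFF[symmetric] algebra_simps)
  then have "monom 1 n dvd \<Delta>"
    using dvd by (simp add: fps_X_power_dvd_fps_of_poly_iff[symmetric])
  then have "coeff \<Delta> k = 0" if "k < n" for k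
    using that by (simp add: monom_1_dvd_iff')
  moreover have "coeff \<Delta> k = 0" if "k > n" for k
    using that deg by (simp add: \<Delta>_def coeff_eq_0)
  ultimately have \<Delta>: "\<Delta> = monom (coeff \<Delta> n) n"
    by (intro poly_eqI) (metis coeff_monom linorder_neqE_nat)
  define c where "c = coeff \<Delta> n"
  have c: "c \<noteq> 0"
  proof
    assume "c = 0"
    then have "P1 = P2" using \<Delta> by (simp add: c_def \<Delta>_def)
    then have "degree P1 = degree P2" by simp
    then show False unfolding deg1 deg2 by (auto split: if_splits) presburger
  qed
  \<comment> \<open>Read off from \<open>h * (F * s - r)^2 = p + q * Y\<close>, which vanishes to
    order \<open>2 * n\<close> at 0.\<close>
  define p q where "p = P1 + P2" and "q = - 2 * (r * s)"
  define N where "N = scal p + scal q * lax 0"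
  have n0: "n > 0" using n(2) by linarith
  have "fps_of_poly p + fps_of_poly q * Y = ?H * (F * ?S - ?R) * (F * ?S - ?R)"
    by (simp add: p_def q_def P1_def P2_def fps_of_poly_simps HFF[symmetric] FH[symmetric] algebra_simps)
  then have pqY: "fps_X ^ (2 * n) dvd fps_of_poly p + fps_of_poly q * Y"
    using mult_dvd_mono[OF dvd dvd] by (simp add: mult_2 power_add mult.assoc)
  have "fps_mat (N * adj2 (monodromy n)) =
      scal (fps_of_poly p + fps_of_poly q * Y) * adj2 (fps_mat (monodromy n)) -
      scal (fps_of_poly q) * adj2 (fps_mat (monodromy n) * (fps_mat (lax 0) + scal Y))"
  proof -
    \<comment> \<open>\<open>p + q L = (p + q Y) - q (Y - L)\<close>: the first part vanishes to
      order \<open>2 * n\<close>, and \<open>Y - L\<close> is the adjugate of \<open>L + Y\<close>,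
      which the monodromy annihilates to that order.\<close>
    have "fps_mat N = scal (fps_of_poly p + fps_of_poly q * Y) -
        scal (fps_of_poly q) * (scal Y - fps_mat (lax 0))"
      by (simp add: N_def fps_mat_add fps_mat_mult fps_mat_scal scal_add right_diff_distrib)
    then show ?thesis
      by (simp add: fps_mat_mult fps_mat_adj2 adj2_mult lax_adj left_diff_distrib right_diff_distrib
          mult.assoc scal_scal_mult)
  qed
  then have "mdvd (fps_X ^ (2 * n)) (fps_mat (N * adj2 (monodromy n)))"
    by (simp only:) (intro mdvd_diff mdvd_scal_mult[OF pqY] mdvd_monodromy mdvd_mult_left mdvd_adj2)
  then have div: "mdvd (monom 1 (2 * n)) (N * adj2 (monodromy n))"
    by (simp only: mdvd_fps_mat_iff)
  have deg_q: "degree q + 2 \<le> n"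
  proof -
    have "q = - (r * s + r * s)"
      by (simp only: q_def mult_minus_left mult_2)
    then have "degree q \<le> degree r + degree s"
      using degree_add_le[OF degree_mult_le[of r s] degree_mult_le[of r s]]
      by (simp only: degree_minus)
    then show ?thesis using s r K n by linarith
  qed
  have deg_p: "degree p \<le> n"
    unfolding p_def using deg by (intro degree_add_le)
  have NM: "N = scal [:coeff p n:] * monodromy n"
    by (rule commuting_matrix_eq_monodromy[OF n0 N_def div deg_p deg_q])
  have pP: "p = \<Delta> + (P2 + P2)" "p = P1 + P1 - \<Delta>"
    by (simp_all add: p_def \<Delta>_def)
  \<comment> \<open>By parity only \<open>P1\<close> can reach degree \<open>n\<close> when
    \<open>n\<close> is even, and only \<open>P2\<close> when \<open>n\<close> is odd.\<close>
  have lead: "coeff p n = (if K = m then c else - c)"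
  proof (cases "K = m")
    case True
    then have "degree P2 < n" using deg2 r n by (auto split: if_splits)
    then have "coeff P2 n = 0" by (rule coeff_eq_0)
    then show ?thesis using True unfolding pP(1) coeff_add by (simp add: c_def)
  next
    case False
    then have "degree P1 < n" using deg1 s n K by auto
    then have "coeff P1 n = 0" by (rule coeff_eq_0)
    then show ?thesis using False unfolding pP(2) coeff_add coeff_diff by (simp add: c_def)
  qed
  \<comment> \<open>At a root of \<open>h\<close> the part \<open>P2\<close> vanishes and
    \<open>p = \<Delta>\<close>; at the remaining roots \<open>P1\<close> vanishes and
    \<open>p = - \<Delta>\<close>.\<close>
  have p_root: "poly p z = (if poly h z = 0 then c * z ^ n else - (c * z ^ n))"
    if "poly (cubic a b g) z = 0" for z
  proof -
    have D: "poly \<Delta> z = c * z ^ n"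
      by (subst \<Delta>) (simp add: poly_monom c_def)
    show ?thesis
    proof (cases "poly h z = 0")
      case True
      then show ?thesis by (simp add: pP(1) P2_def D)
    next
      case False
      then have "poly h' z = 0" using that h(2)[symmetric] by simp
      then show ?thesis using False by (simp add: pP(2) P1_def D)
    qed
  qed
  have \<tau>: "z = \<tau> r * z'" if "poly p r * z' = coeff p n * r ^ n * z" "poly (cubic a b g) r = 0" "r \<noteq> 0"
    for r z z' :: real
  proof -
    define e where "e = c * r ^ n"
    have "e \<noteq> 0" using that(3) c by (simp add: e_def)
    have "(if poly h r = 0 then e else - e) * z' = (if K = m then e else - e) * z"
      using that(1) unfolding p_root[OF that(2)] lead by (auto simp: e_def)
    then have "e * ((if poly h r = 0 then 1 else - 1) * z') = e * ((if K = m then 1 else - 1) * z)"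
      by (cases "poly h r = 0"; cases "K = m")
         (simp_all only: if_True if_False mult_minus_left mult_minus_right mult_1 simp_thms)
    then have "(if poly h r = 0 then 1 else - 1) * z' = (if K = m then 1 else - 1) * z"
      using \<open>e \<noteq> 0\<close> mult_left_cancel by blast
    then show ?thesis
      unfolding \<tau>_def by (auto split: if_splits)
  qed
  have "poly (cubic a b g) a = 0" "poly (cubic a b g) (- b) = 0" "a \<noteq> 0" "- b \<noteq> 0"
    using ab by (simp_all add: poly_cubic)
  then show "x n = \<tau> a * x 0" "u n = \<tau> a * u 0" "y n = \<tau> (- b) * y 0" "v n = \<tau> (- b) * v 0"
    using monodromy_eigenvalue[OF NM[unfolded N_def]] by (auto intro!: \<tau>)
qed

end

section \<open>From symmetric orbits to Pade approximants\<close>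

lemma two_roots_dvd:
  fixes p :: "real poly"
  assumes "poly p r1 = 0" "poly p r2 = 0" "r1 \<noteq> r2"
  shows "[:- r1, 1:] * [:- r2, 1:] dvd p"
proof -
  obtain k where k: "p = [:- r1, 1:] * k"
    using assms(1) by (auto simp: poly_eq_0_iff_dvd)
  then have "poly k r2 = 0" using assms by simp
  then show ?thesis
    unfolding k by (intro mult_dvd_mono) (auto simp: poly_eq_0_iff_dvd)
qed

lemma factor_pair_eq_up_to_const:
  fixes f1 f2 A B :: "real poly"
  assumes "f1 * f2 = A * B" "A * B \<noteq> 0" "A dvd f1" "B dvd f2"
  obtains \<kappa> where "\<kappa> \<noteq> 0" "f1 = smult (1 / \<kappa>) A" "f2 = smult \<kappa> B"
proof -
  obtain k l where kl: "f1 = A * k" "f2 = B * l" using assms(3,4) by (auto elim!: dvdE)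
  have "(A * B) * (k * l) = (A * B) * 1"
    using assms(1) by (simp add: kl ac_simps)
  then have "k * l = 1"
    using assms(2) mult_left_cancel by blast
  then have "is_unit l" "is_unit k" by (metis dvd_triv_right, metis dvd_triv_left)
  then obtain c d where cd: "l = [:c:]" "k = [:d:]"
    using is_unit_polyE by metis
  then have "c * d = 1" using \<open>k * l = 1\<close> by (simp add: one_pCons mult.commute)
  then have "c \<noteq> 0" "d = 1 / c" by (auto simp: eq_divide_eq mult.commute)
  then show ?thesis using that[of c] kl cd by simp
qed

text \<open>\<open>q\<close> splits along the two coprime factors, and the square of each part
  divides its own factor.\<close>

lemma coprime_product_eq_square_times:
  fixes P Q q f :: "'a::semiring_gcd"
  assumes "P * Q = q * q * f" "coprime P Q" "q \<noteq> 0"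
  obtains r s f1 f2 where "q = r * s" "P = r * r * f1" "Q = s * s * f2" "f1 * f2 = f"
proof -
  have "q dvd P * Q" unfolding assms(1) by (simp add: mult.assoc)
  then obtain r s where rs: "q = r * s" "r dvd P" "s dvd Q"
    using division_decomp by blast
  have "coprime (r * r) Q" "coprime (s * s) P"
    using assms(2) rs by (auto intro: coprime_divisors[OF _ dvd_refl] simp: coprime_commute)
  moreover have "P * Q = (r * r) * (s * s * f)" "P * Q = (s * s) * (r * r * f)"
    unfolding assms(1) rs by (simp_all only: ac_simps)
  then have "r * r dvd P * Q" "s * s dvd P * Q"
    by (metis dvd_triv_left)+
  ultimately have "r * r dvd P" "s * s dvd Q"
    by (auto simp: coprime_dvd_mult_left_iff coprime_dvd_mult_right_iff)
  then obtain f1 f2 where f: "P = r * r * f1" "Q = s * s * f2" by (auto elim!: dvdE)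
  then have "(q * q) * (f1 * f2) = (q * q) * f"
    using assms(1) unfolding rs by (simp add: ac_simps)
  then have "f1 * f2 = f"
    using assms(3) by simp
  then show ?thesis using that rs f by blast
qed

context billiard_orbit
begin

text \<open>For a segment along an axis the caustic equation would make the whole velocity vanish,
  since \<open>g\<close> is neither \<open>a\<close> nor \<open>- b\<close>.\<close>

lemma phase_point_neq_0: "x k \<noteq> 0 \<or> u k \<noteq> 0" "y k \<noteq> 0 \<or> v k \<noteq> 0"
  using caustic[of k] energy[of k] g by (auto simp: sgn_zero_iff)

lemma symmetry_imp_lax_eq:
  assumes "x n = \<sigma> * x 0" "u n = \<sigma> * u 0" "y n = \<tau> * y 0" "v n = \<tau> * v 0" "\<sigma>\<^sup>2 = 1" "\<tau>\<^sup>2 = 1"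
  shows "lax n = lax 0"
proof -
  have "x n * u n = x 0 * u 0" "y n * v n = y 0 * v 0" "(x n)\<^sup>2 = (x 0)\<^sup>2" "(u n)\<^sup>2 = (u 0)\<^sup>2"
    "(y n)\<^sup>2 = (y 0)\<^sup>2" "(v n)\<^sup>2 = (v 0)\<^sup>2"
    using assms(5,6) by (simp_all add: assms(1-4) power_mult_distrib power2_eq_square)
  then show ?thesis
    by (simp add: lax_def alpha_def beta_def delta_def mult.assoc)
qed

text \<open>A common zero of the Lax entries would be a double root of the cubic. Without one, the
  linear polynomial \<open>delta 0\<close> divides the lower left entry, and the quotient determines
  \<open>q\<close>.\<close>

lemma monodromy_in_commutant:
  assumes "lax n = lax 0"
  obtains p q where "monodromy n = scal p + scal q * lax 0"
proof -
  let ?A = "alpha 0" and ?B = "beta 0" and ?D = "delta 0" and ?M = "monodromy n"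
  have comm: "?M * lax 0 = lax 0 * ?M"
    using monodromy_lax[of n] assms by simp
  have e1: "m12 ?M * ?D = - (?B * m21 ?M)"
    using arg_cong[OF comm, of m11] by (simp add: mat2_mult_sel lax_def algebra_simps)
  have e2: "?D * (m22 ?M - m11 ?M) = - (?A * m21 ?M + ?A * m21 ?M)"
    using arg_cong[OF comm, of m21] by (simp add: mat2_mult_sel lax_def algebra_simps)
  define z where "z = - coeff ?D 0 / coeff ?D 1"
  have D1: "coeff ?D 1 \<noteq> 0"
    using g energy[of 0] by (simp add: delta_def sgn_zero_iff)
  then have D: "?D = smult (coeff ?D 1) [:- z, 1:]"
    by (simp add: z_def delta_def)
  have Dz: "poly ?D z = 0"
    using D1 by (simp add: z_def delta_def)
  have "poly (m21 ?M) z = 0"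
  proof (rule ccontr)
    assume *: "poly (m21 ?M) z \<noteq> 0"
    have "poly ?B z * poly (m21 ?M) z = 0"
      using arg_cong[OF e1, of "\<lambda>P. poly P z"] Dz by simp
    then have Bz: "poly ?B z = 0" using * by simp
    have "poly ?A z * poly (m21 ?M) z = 0"
      using arg_cong[OF e2, of "\<lambda>P. poly P z"] Dz by auto
    then have Az: "poly ?A z = 0" using * by simp
    have "poly (cubic a b g) z = 0" "poly (pderiv (cubic a b g)) z = 0"
      unfolding alpha_beta_delta[of 0, symmetric] using Az Bz Dz
      by (simp_all add: pderiv_diff pderiv_mult)
    then show False using pderiv_cubic_neq_0 ab g by blast
  qed
  then have "[:- z, 1:] dvd m21 ?M" by (simp add: poly_eq_0_iff_dvd)
  then have "?D dvd m21 ?M" using D D1 by (metis smult_dvd_iff)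
  then obtain q' where q': "m21 ?M = ?D * q'" ..
  define q where "q = - q'"
  have q: "m21 ?M = - (q * ?D)" by (simp add: q' q_def)
  have "?D \<noteq> 0" using D1 by auto
  have "?D * m12 ?M = ?D * (q * ?B)" using e1 unfolding q by (simp add: algebra_simps)
  then have m12: "m12 ?M = q * ?B" using \<open>?D \<noteq> 0\<close> mult_left_cancel by blast
  have "?D * (m22 ?M - m11 ?M) = ?D * (q * ?A + q * ?A)"
    unfolding e2 q by (simp add: algebra_simps)
  then have "m22 ?M - m11 ?M = q * ?A + q * ?A" using \<open>?D \<noteq> 0\<close> mult_left_cancel by blast
  then have m22: "m22 ?M = (m11 ?M + q * ?A) + q * ?A" by (simp add: algebra_simps)
  have "?M = scal (m11 ?M + q * ?A) + scal q * lax 0"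
    using q m12 m22 by (intro mat2.expand) (simp add: lax_def)
  then show ?thesis using that by blast
qed

end

context billiard_orbit_root
begin

text \<open>The Pell equation reads \<open>h * (F * s + r) * (F * s - r) = c * z^(m + K)\<close>. At
  0 the two brackets cannot both vanish, so one is a unit and the other carries the full power of
  \<open>z\<close>.\<close>

lemma pell_imp_pade:
  fixes h h' s r :: "real poly"
  assumes h: "h * h' = cubic a b g" "poly h 0 \<noteq> 0"
    and pell: "h' * (s * s) - h * (r * r) = monom c (m + K)"
    and s: "s \<noteq> 0" "degree s < m" and r: "degree r < K"
    and sr: "poly s 0 \<noteq> 0 \<or> poly r 0 \<noteq> 0"
  shows "\<exists>s r. pade m K (Y / fps_of_poly h) s r"
proof -
  define F where "F = Y / fps_of_poly h"
  let ?H = "fps_of_poly h" and ?S = "fps_of_poly s" and ?R = "fps_of_poly r"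
  have H: "is_unit ?H"
    using h(2) by (simp add: fps_is_unit_iff poly_0_coeff_0)
  have FH: "?H * F = Y" and HFF: "?H * (F * F) = fps_of_poly h'"
    using root_quotient[OF h] by (simp_all add: F_def)
  have "?H * ((F * ?S + ?R) * (F * ?S - ?R)) = fps_of_poly (monom c (m + K))"
    unfolding pell[symmetric]
    by (simp add: fps_of_poly_simps HFF[symmetric] algebra_simps)
  then have "fps_X ^ (m + K) dvd ?H * ((F * ?S + ?R) * (F * ?S - ?R))"
    by (simp add: fps_of_poly_monom)
  then have dvd: "fps_X ^ (m + K) dvd (F * ?S + ?R) * (F * ?S - ?R)"
    using H by (simp add: dvd_mult_unit_iff')
  have "fps_nth ?H 0 * fps_nth F 0 = fps_nth Y 0"
    by (simp flip: FH)
  then have F0: "fps_nth F 0 \<noteq> 0" using Y_pos by auto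
  have False if "fps_nth F 0 * poly s 0 + poly r 0 = 0" "fps_nth F 0 * poly s 0 - poly r 0 = 0"
  proof -
    have "poly r 0 = 0" using that by linarith
    then show False using that F0 sr by simp
  qed
  moreover have "fps_nth (F * ?S + ?R) 0 = fps_nth F 0 * poly s 0 + poly r 0"
    "fps_nth (F * ?S - ?R) 0 = fps_nth F 0 * poly s 0 - poly r 0"
    by (simp_all add: poly_0_coeff_0)
  ultimately consider "fps_nth (F * ?S + ?R) 0 \<noteq> 0" | "fps_nth (F * ?S - ?R) 0 \<noteq> 0"
    by metis
  then show ?thesis
  proof cases
    case 1
    then have "fps_X ^ (m + K) dvd F * ?S - ?R"
      using dvd by (simp add: dvd_mult_unit_iff' fps_is_unit_iff)
    then have "pade m K F s r" using s r by (simp add: pade_def)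
    then show ?thesis unfolding F_def by blast
  next
    case 2
    then have "fps_X ^ (m + K) dvd F * ?S + ?R"
      using dvd by (simp add: dvd_mult_unit_iff fps_is_unit_iff)
    then have "pade m K F s (- r)" using s r by (simp add: pade_def fps_of_poly_uminus)
    then show ?thesis unfolding F_def by blast
  qed
qed

text \<open>With \<open>monodromy n = p + q * lax 0\<close>, taking determinants factors \<open>q\<^sup>2 * cubic a b g\<close> as
  \<open>(p - z\<^sup>n) * (p + z\<^sup>n)\<close>. The factors are coprime, so each is a square times a part of the cubic,
  and which roots of the cubic go where is decided by the signs of the symmetry.\<close>

lemma symmetry_imp_pell:
  assumes n: "n > 0"
    and sym: "x n = \<sigma> * x 0" "u n = \<sigma> * u 0" "y n = \<tau> * y 0" "v n = \<tau> * v 0"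
    and signs: "\<sigma> = 1 \<or> \<sigma> = - 1" "\<tau> = 1 \<or> \<tau> = - 1"
  obtains p r s f1 f2 :: "real poly" where
    "p - monom 1 n = r * r * f1" "p + monom 1 n = s * s * f2" "f1 * f2 = cubic a b g"
    "degree (p - monom 1 n) < n" "poly p 0 \<noteq> 0" "poly p a = \<sigma> * a ^ n" "poly p (- b) = \<tau> * (- b) ^ n"
proof -
  have "lax n = lax 0"
    using symmetry_imp_lax_eq[OF sym] signs by auto
  then obtain p q where M: "monodromy n = scal p + scal q * lax 0"
    using monodromy_in_commutant by blast
  have sel: "m11 (monodromy n) = p - q * alpha 0" "m21 (monodromy n) = - (q * delta 0)"
    "m22 (monodromy n) = p + q * alpha 0"
    by (simp_all add: M lax_def)
  have z2n: "monom 1 (2 * n) = monom (1::real) n * monom 1 n"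
    by (simp add: mult_monom mult_2)
  have "det2 (monodromy n) = p * p - q * q * (alpha 0 * alpha 0 - beta 0 * delta 0)"
    by (simp add: M det2_def lax_def algebra_simps)
  then have "p * p - q * q * cubic a b g = monom 1 n * monom 1 n"
    by (simp add: det_monodromy alpha_beta_delta z2n)
  then have PQ: "(p - monom 1 n) * (p + monom 1 n) = q * q * cubic a b g"
    by (simp add: algebra_simps)
  \<comment> \<open>The upper left entry vanishes at 0, so there \<open>p = q * alpha 0\<close> and
    the nonzero lower right entry is \<open>2 * p\<close>.\<close>
  have p0: "poly p 0 \<noteq> 0"
    using monodromy_at_0(1,3)[OF n] by (auto simp: sel)
  \<comment> \<open>The lower left entry \<open>- q * delta 0\<close> has degree at most
    \<open>n - 1\<close>. As \<open>delta 0\<close> has degree 1 and \<open>alpha 0\<close> at most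
    1, the product \<open>q * alpha 0\<close> stays below degree \<open>n\<close>.\<close>
  have deg_q: "coeff (q * alpha 0) k = 0" if "k \<ge> n" for k
  proof (cases "q = 0")
    case False
    have "coeff (delta 0) 1 \<noteq> 0"
      using g energy[of 0] by (simp add: delta_def sgn_zero_iff)
    then have "degree (delta 0) \<ge> 1" "delta 0 \<noteq> 0" by (auto intro: le_degree)
    then have "degree (q * delta 0) \<ge> degree q + 1"
      using False by (simp add: degree_mult_eq)
    moreover have "degree (q * delta 0) \<le> n - 1"
      using monodromy_degree(4)[OF n] by (simp add: sel)
    moreover have "degree (alpha 0) \<le> 1"
      by (auto simp: alpha_def)
    ultimately have "degree (q * alpha 0) < n"
      using degree_mult_le[of q "alpha 0"] n by linarith
    then show ?thesis using that by (simp add: coeff_eq_0)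
  qed simp
  have "coeff p k = coeff (m11 (monodromy n)) k" if "k \<ge> n" for k
    using deg_q[OF that] by (simp add: sel)
  then have "coeff p n = 1" "\<And>k. k > n \<Longrightarrow> coeff p k = 0"
    using monodromy_lead(1) monodromy_coeff_above(1) by auto
  then have "degree (p - monom 1 n) \<le> n - 1"
    by (intro degree_le) (auto simp: not_le)
  then have deg: "degree (p - monom 1 n) < n" using n by linarith
  have ev: "scal p + scal q * lax 0 = scal [:1:] * monodromy n"
    by (simp add: M one_pCons[symmetric])
  have "poly p a * \<xi> = \<sigma> * a ^ n * \<xi>" if "\<xi> \<in> {x 0, u 0}" for \<xi>
    using monodromy_eigenvalue(1,2)[OF ev] that by (auto simp: sym)
  then have pa: "poly p a = \<sigma> * a ^ n"
    using phase_point_neq_0(1)[of 0] by auto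
  have "poly p (- b) * \<xi> = \<tau> * (- b) ^ n * \<xi>" if "\<xi> \<in> {y 0, v 0}" for \<xi>
    using monodromy_eigenvalue(3,4)[OF ev] that by (auto simp: sym)
  then have pb: "poly p (- b) = \<tau> * (- b) ^ n"
    using phase_point_neq_0(2)[of 0] by auto
  \<comment> \<open>A common divisor divides \<open>2 * z^n\<close>, and it is prime to
    \<open>z\<close> because \<open>p\<close> does not vanish at 0.\<close>
  have "coprime (p - monom 1 n) (p + monom 1 n)"
  proof (rule coprimeI)
    fix c assume c: "c dvd p - monom 1 n" "c dvd p + monom 1 n"
    then have "c dvd (p + monom 1 n) - (p - monom 1 n)" by (rule dvd_diff[rotated])
    also have "(p + monom 1 n) - (p - monom 1 n) = monom 1 n + monom 1 n"
      by simp
    also have "\<dots> = smult 2 (monom 1 n)"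
      by (simp only: add_monom smult_monom) simp
    finally have "c dvd monom 1 n" by (simp add: dvd_smult_iff)
    then have "c dvd [:0, 1:] ^ n" by (simp add: monom_altdef)
    moreover have "coprime c [:0, 1:]"
    proof (rule coprimeI)
      fix d assume d: "d dvd c" "d dvd [:0, 1 :: real:]"
      then have "d dvd p + monom 1 n" using c dvd_trans by blast
      moreover have "d dvd monom 1 n"
        using dvd_trans[OF d(2), of "[:0, 1:] ^ n"] n by (simp add: monom_altdef dvd_power)
      ultimately have "d dvd p" using dvd_add_left_iff by blast
      moreover obtain p1 where "p = [:poly p 0:] + [:0, 1:] * p1"
        by (cases p) auto
      ultimately have "d dvd [:poly p 0:]" using d(2) by (metis dvd_add_left_iff dvd_mult2)
      moreover have "is_unit [:poly p 0:]" using p0 by (simp add: is_unit_const_poly_iff dvd_field_iff)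
      ultimately show "is_unit d" using dvd_trans by blast
    qed
    then have "coprime c ([:0, 1:] ^ n)" by simp
    ultimately show "is_unit c" using coprime_common_divisor[OF _ dvd_refl] by blast
  qed
  moreover have "q \<noteq> 0"
  proof
    assume "q = 0"
    then have "poly ((p - monom 1 n) * (p + monom 1 n)) 0 = 0" unfolding PQ by simp
    then show False using p0 n by (simp add: poly_monom power_0_left)
  qed
  ultimately obtain r s f1 f2 where
    "p - monom 1 n = r * r * f1" "p + monom 1 n = s * s * f2" "f1 * f2 = cubic a b g"
    using coprime_product_eq_square_times[OF PQ] by metis
  then show ?thesis using that deg p0 pa pb by blast
qed

text \<open>The roots of the cubic are distributed over \<open>f1\<close> and \<open>f2\<close>. The
  number of roots in \<open>f2\<close> fixes the parity of \<open>n\<close>, and the sign of the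
  Pell equation at these roots restricts \<open>g\<close>.\<close>

lemma symmetry_imp_pade:
  assumes n: "n \<ge> 2"
    and sym: "x n = \<sigma> * x 0" "u n = \<sigma> * u 0" "y n = \<tau> * y 0" "v n = \<tau> * v 0"
    and signs: "\<sigma> = 1 \<or> \<sigma> = - 1" "\<tau> = 1 \<or> \<tau> = - 1" "\<sigma> = - 1 \<or> \<tau> = - 1"
  shows "(\<exists>m>0. n = 2 * m \<and> (\<exists>\<rho> s r. pade m m (Y / fps_of_poly [:- \<rho>, 1:]) s r \<and>
            (\<rho> = a \<and> 0 < g \<and> g < a \<or> \<rho> = - b \<and> - b < g \<and> g < 0 \<or> \<rho> = g \<and> (g < - b \<or> a < g)))) \<or>
         (\<exists>m>0. n = 2 * m + 1 \<and> (\<exists>\<rho> s r. pade m (m + 1) (Y / fps_of_poly [:- \<rho>, 1:]) s r \<and>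
            (\<rho> = a \<and> \<not> (0 < g \<and> g < a) \<or> \<rho> = - b \<and> \<not> (- b < g \<and> g < 0))))"
proof -
  define e where "e = sgn g"
  have e: "e \<noteq> 0" using g by (simp add: e_def sgn_zero_iff)
  have n0: "n > 0" using n by simp
  obtain p r s f1 f2 where P: "p - monom 1 n = r * r * f1" and Q: "p + monom 1 n = s * s * f2"
    and f: "f1 * f2 = cubic a b g" and degP: "degree (p - monom 1 n) < n" and p0: "poly p 0 \<noteq> 0"
    and pab: "poly p a = \<sigma> * a ^ n" "poly p (- b) = \<tau> * (- b) ^ n"
    using symmetry_imp_pell[OF n0 sym signs(1,2)] by metis
  have "poly (r * r * f1) 0 \<noteq> 0" "poly (s * s * f2) 0 \<noteq> 0"
    unfolding P[symmetric] Q[symmetric] using p0 n0 by (simp_all add: poly_monom power_0_left)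
  then have r: "r \<noteq> 0" "poly r 0 \<noteq> 0" and s: "s \<noteq> 0" "poly s 0 \<noteq> 0"
    by auto
  have Q_eq: "s * s * f2 = (r * r * f1) + (monom 1 n + monom 1 n)"
    unfolding P[symmetric] Q[symmetric] by simp
  have two: "monom 1 n + monom 1 n = monom (2::real) n" by (simp only: add_monom) simp
  note Q_eq = Q_eq[unfolded two]
  have degP': "degree (r * r * f1) < n" using degP by (simp add: P)
  then have "coeff (s * s * f2) n = 2" "\<And>k. k > n \<Longrightarrow> coeff (s * s * f2) k = 0"
    unfolding Q_eq by (simp_all add: coeff_eq_0)
  then have degQ: "degree (s * s * f2) = n" and leadQ: "lead_coeff (s * s * f2) = 2"
    by (metis degree_le le_antisym le_degree not_less zero_neq_numeral)+
  have PQ_root: "poly (r * r * f1) \<rho> = poly (s * s * f2) \<rho> - 2 * \<rho> ^ n" for \<rho>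
    by (simp add: Q_eq poly_monom)
  have root: "poly f2 \<rho> = 0 \<and> poly f1 \<rho> \<noteq> 0 \<and> poly r \<rho> \<noteq> 0 \<and> poly (s * s * f2) \<rho> = 0 \<or>
      poly f1 \<rho> = 0 \<and> poly (s * s * f2) \<rho> \<noteq> 0"
    if "poly (cubic a b g) \<rho> = 0" "\<rho> \<noteq> 0" for \<rho>
    using that PQ_root[of \<rho>] by (auto simp flip: f)
  have square_mult_neg: "E < 0" if "\<xi>\<^sup>2 * E < 0" for \<xi> E :: real
    using that by (metis mult_nonneg_nonneg not_less zero_le_power2)
  \<comment> \<open>Two roots lie in \<open>f2\<close> and \<open>h\<close> is the linear factor in
    \<open>f1\<close>. At each of the two, \<open>r^2 * f1 = - 2 * \<rho>^n\<close> is negative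
    because \<open>n\<close> is even.\<close>
  have even_case: "\<exists>m>0. n = 2 * m \<and> (\<exists>s r. pade m m (Y / fps_of_poly [:- \<rho>3, 1:]) s r) \<and>
        e * (\<rho>1 - \<rho>3) < 0 \<and> e * (\<rho>2 - \<rho>3) < 0"
    if cub: "cubic a b g = smult e ([:- \<rho>1, 1:] * [:- \<rho>2, 1:] * [:- \<rho>3, 1:])"
      and \<rho>: "\<rho>1 \<noteq> \<rho>2" "\<rho>1 \<noteq> 0" "\<rho>2 \<noteq> 0" "\<rho>3 \<noteq> 0"
      and f2: "poly f2 \<rho>1 = 0" "poly f2 \<rho>2 = 0" "poly r \<rho>1 \<noteq> 0" "poly r \<rho>2 \<noteq> 0" and f1: "poly f1 \<rho>3 = 0"
    for \<rho>1 \<rho>2 \<rho>3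
  proof -
    define h h' where "h = [:- \<rho>3, 1:]" and "h' = smult e ([:- \<rho>1, 1:] * [:- \<rho>2, 1:])"
    have hh: "h * h' = cubic a b g" unfolding cub h_def h'_def by (simp only: mult_smult_right ac_simps)
    have hh0: "h * h' \<noteq> 0" unfolding hh using cubic_neq_0[OF g(1)] .
    have dvds: "h dvd f1" "h' dvd f2"
      using f1 two_roots_dvd[OF f2(1,2) \<rho>(1)] e
      unfolding h_def h'_def smult_dvd_iff poly_eq_0_iff_dvd by (blast, presburger)
    obtain \<kappa> where \<kappa>: "\<kappa> \<noteq> 0" "f1 = smult (1 / \<kappa>) h" "f2 = smult \<kappa> h'"
      using factor_pair_eq_up_to_const[OF f[folded hh] hh0 dvds] .
    have deg_h: "degree h = 1" "degree h' = 2"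
      using e by (simp_all add: h_def h'_def)
    have "h \<noteq> 0" "h' \<noteq> 0" using hh0 by auto
    have lead: "lead_coeff h = 1" "lead_coeff h' = e"
      by (simp add: h_def) (simp only: h'_def lead_coeff_smult lead_coeff_mult, simp)
    define m where "m = Suc (degree s)"
    then have m: "m > 0" by simp
    have n_eq: "n = 2 * m"
      using degQ s \<kappa> \<open>h' \<noteq> 0\<close> deg_h by (simp add: degree_mult_eq m_def)
    have "degree (r * r * f1) = 1 + 2 * degree r"
      using r \<kappa> \<open>h \<noteq> 0\<close> deg_h by (simp add: degree_mult_eq)
    then have deg_r: "degree r < m" using degP' n_eq by linarith
    have "(lead_coeff s)\<^sup>2 * (\<kappa> * e) = 2"
      using leadQ unfolding \<kappa>(3) by (simp only: lead_coeff_mult lead_coeff_smult lead power2_eq_square)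
    then have "\<kappa> * e > 0"
      by (metis mult_nonneg_nonpos not_less zero_le_power2 zero_less_numeral)
    then have "1 / \<kappa> * e > 0" by (auto simp: zero_less_mult_iff zero_less_divide_iff)
    have sign: "e * (\<rho> - \<rho>3) < 0" if "poly f2 \<rho> = 0" "poly r \<rho> \<noteq> 0" "\<rho> \<noteq> 0" for \<rho>
    proof -
      have "(poly r \<rho>)\<^sup>2 * (1 / \<kappa> * (\<rho> - \<rho>3)) = - 2 * \<rho> ^ n"
        using PQ_root[of \<rho>] that(1)
        by (simp add: \<kappa>(2) h_def power2_eq_square algebra_simps diff_divide_distrib)
      also have "\<dots> < 0" using that(3) n_eq by (simp add: power_mult)
      finally have "1 / \<kappa> * (\<rho> - \<rho>3) < 0"
        by (rule square_mult_neg)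
      then show ?thesis using \<open>1 / \<kappa> * e > 0\<close> by (auto simp: mult_less_0_iff divide_less_0_iff zero_less_mult_iff zero_less_divide_iff)
    qed
    have "h' * (smult \<kappa> s * smult \<kappa> s) - h * (r * r) = smult \<kappa> (s * s * f2 - r * r * f1)"
      using \<kappa>(1) by (simp add: \<kappa>(2,3) smult_diff_right ac_simps)
    also have "\<dots> = monom (2 * \<kappa>) n"
      by (simp add: Q_eq smult_monom)
    also have "n = m + m" using n_eq by simp
    finally have pell: "h' * (smult \<kappa> s * smult \<kappa> s) - h * (r * r) = monom (2 * \<kappa>) (m + m)" .
    have "\<exists>s r. pade m m (Y / fps_of_poly h) s r"
      by (rule pell_imp_pade[OF hh _ pell])
         (use r s \<kappa>(1) \<rho>(4) deg_r in \<open>auto simp: h_def m_def\<close>)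
    then show ?thesis
      using sign[OF f2(1,3) \<rho>(2)] sign[OF f2(2,4) \<rho>(3)] n_eq m unfolding h_def by blast
  qed
  \<comment> \<open>Only \<open>\<rho>3\<close> lies in \<open>f2\<close>, so \<open>h\<close>
    divides \<open>f2\<close> and \<open>r\<close>, \<open>s\<close> exchange their roles. For odd
    \<open>n\<close> the power \<open>\<rho>3^n\<close> has the sign of \<open>\<rho>3\<close>,
    hence the extra factor.\<close>
  have odd_case: "\<exists>m>0. n = 2 * m + 1 \<and> (\<exists>s r. pade m (m + 1) (Y / fps_of_poly [:- \<rho>3, 1:]) s r) \<and>
        e * (\<rho>3 - \<rho>1) * (\<rho>3 - \<rho>2) * \<rho>3 < 0"
    if cub: "cubic a b g = smult e ([:- \<rho>1, 1:] * [:- \<rho>2, 1:] * [:- \<rho>3, 1:])"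
      and \<rho>: "\<rho>1 \<noteq> \<rho>2" "\<rho>3 \<noteq> 0"
      and f1: "poly f1 \<rho>1 = 0" "poly f1 \<rho>2 = 0" and f2: "poly f2 \<rho>3 = 0" "poly r \<rho>3 \<noteq> 0"
    for \<rho>1 \<rho>2 \<rho>3
  proof -
    define h h' where "h = [:- \<rho>3, 1:]" and "h' = smult e ([:- \<rho>1, 1:] * [:- \<rho>2, 1:])"
    have hh: "h * h' = cubic a b g" unfolding cub h_def h'_def by (simp only: mult_smult_right ac_simps)
    have hh0: "h' * h \<noteq> 0" unfolding mult.commute[of h'] hh using cubic_neq_0[OF g(1)] .
    have f': "f1 * f2 = h' * h" by (simp only: f hh mult.commute[of h'])
    have dvds: "h' dvd f1" "h dvd f2"
      using f2(1) two_roots_dvd[OF f1 \<rho>(1)] e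
      unfolding h_def h'_def smult_dvd_iff poly_eq_0_iff_dvd by (presburger, blast)
    obtain \<kappa> where \<kappa>: "\<kappa> \<noteq> 0" "f1 = smult (1 / \<kappa>) h'" "f2 = smult \<kappa> h"
      using factor_pair_eq_up_to_const[OF f' hh0 dvds] .
    have deg_h: "degree h = 1" "degree h' = 2"
      using e by (simp_all add: h_def h'_def)
    have "h \<noteq> 0" "h' \<noteq> 0" using hh0 by auto
    have lead: "lead_coeff h = 1" "lead_coeff h' = e"
      by (simp add: h_def) (simp only: h'_def lead_coeff_smult lead_coeff_mult, simp)
    define m where "m = degree s"
    have n_eq: "n = 2 * m + 1"
      using degQ s \<kappa> \<open>h \<noteq> 0\<close> deg_h by (simp add: degree_mult_eq m_def)
    then have m: "m > 0" using n by simp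
    have "degree (r * r * f1) = 2 + 2 * degree r"
      using r \<kappa> \<open>h' \<noteq> 0\<close> deg_h by (simp add: degree_mult_eq)
    then have deg_r: "degree r < m" using degP' n_eq by linarith
    have "(lead_coeff s)\<^sup>2 * \<kappa> = 2"
      using leadQ unfolding \<kappa>(3) by (simp only: lead_coeff_mult lead_coeff_smult lead power2_eq_square mult_1_right)
    then have "\<kappa> > 0"
      by (metis mult_nonneg_nonpos not_less zero_le_power2 zero_less_numeral)
    have "(poly r \<rho>3)\<^sup>2 * (1 / \<kappa> * (e * (\<rho>3 - \<rho>1) * (\<rho>3 - \<rho>2))) = - 2 * \<rho>3 ^ n"
      using PQ_root[of \<rho>3] f2(1) by (simp add: \<kappa>(2) h'_def power2_eq_square algebra_simps)
    also have "\<dots> = - 2 * (\<rho>3 ^ m)\<^sup>2 * \<rho>3"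
      by (simp add: n_eq power_even_eq)
    finally have *: "(poly r \<rho>3)\<^sup>2 * (1 / \<kappa> * (e * (\<rho>3 - \<rho>1) * (\<rho>3 - \<rho>2))) =
        - 2 * (\<rho>3 ^ m)\<^sup>2 * \<rho>3" .
    have "(poly r \<rho>3)\<^sup>2 * (1 / \<kappa> * (e * (\<rho>3 - \<rho>1) * (\<rho>3 - \<rho>2) * \<rho>3)) =
        (poly r \<rho>3)\<^sup>2 * (1 / \<kappa> * (e * (\<rho>3 - \<rho>1) * (\<rho>3 - \<rho>2))) * \<rho>3"
      by simp
    also have "\<dots> = - 2 * (\<rho>3 ^ m * \<rho>3)\<^sup>2"
      unfolding * by (simp add: power2_eq_square)
    also have "\<dots> < 0" using \<rho>(2) by simp
    finally have "1 / \<kappa> * (e * (\<rho>3 - \<rho>1) * (\<rho>3 - \<rho>2) * \<rho>3) < 0"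
      by (rule square_mult_neg)
    then have sign: "e * (\<rho>3 - \<rho>1) * (\<rho>3 - \<rho>2) * \<rho>3 < 0"
      using \<open>\<kappa> > 0\<close> by (simp add: divide_less_0_iff)
    have "h' * (r * r) - h * (smult \<kappa> s * smult \<kappa> s) = smult (- \<kappa>) (s * s * f2 - r * r * f1)"
      using \<kappa>(1) by (simp add: \<kappa>(2,3) smult_diff_right ac_simps)
    also have "\<dots> = monom (- 2 * \<kappa>) n"
      by (simp add: Q_eq smult_monom)
    also have "n = m + (m + 1)" using n_eq by simp
    finally have pell: "h' * (r * r) - h * (smult \<kappa> s * smult \<kappa> s) = monom (- 2 * \<kappa>) (m + (m + 1))" .
    have "\<exists>s r. pade m (m + 1) (Y / fps_of_poly h) s r"
      by (rule pell_imp_pade[OF hh _ pell])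
         (use r s \<kappa>(1) \<rho>(2) deg_r in \<open>auto simp: h_def m_def\<close>)
    then show ?thesis
      using sign n_eq m unfolding h_def by blast
  qed
  \<comment> \<open>\<open>s^2 * f2 = p + z^n\<close> equals \<open>(\<sigma> + 1) * a^n\<close> at
    \<open>a\<close> and \<open>(\<tau> + 1) * (- b)^n\<close> at \<open>- b\<close>.\<close>
  have a_root: "poly f2 a = 0 \<longleftrightarrow> \<sigma> = - 1" and b_root: "poly f2 (- b) = 0 \<longleftrightarrow> \<tau> = - 1"
  proof -
    have "poly (s * s * f2) a = \<sigma> * a ^ n + a ^ n" "poly (s * s * f2) (- b) = \<tau> * (- b) ^ n + (- b) ^ n"
      unfolding Q[symmetric] by (simp_all add: pab poly_monom)
    then show "poly f2 a = 0 \<longleftrightarrow> \<sigma> = - 1" "poly f2 (- b) = 0 \<longleftrightarrow> \<tau> = - 1"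
      using root[of a] root[of "- b"] ab signs(1,2) by (auto simp: poly_cubic)
  qed
  have ra: "poly f2 a = 0 \<and> poly f1 a \<noteq> 0 \<and> poly r a \<noteq> 0 \<or> poly f1 a = 0 \<and> poly f2 a \<noteq> 0"
    and rb: "poly f2 (- b) = 0 \<and> poly f1 (- b) \<noteq> 0 \<and> poly r (- b) \<noteq> 0 \<or> poly f1 (- b) = 0 \<and> poly f2 (- b) \<noteq> 0"
    and rg: "poly f2 g = 0 \<and> poly f1 g \<noteq> 0 \<and> poly r g \<noteq> 0 \<or> poly f1 g = 0 \<and> poly f2 g \<noteq> 0"
    using root[of a] root[of "- b"] root[of g] ab g by (auto simp: poly_cubic)
  \<comment> \<open>With the whole cubic in \<open>f2\<close>, \<open>n\<close> is odd and
    \<open>f1\<close> constant, so \<open>- 2 * z^n\<close> would be a constant times a square; but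
    its signs at \<open>a\<close> and \<open>- b\<close> differ.\<close>
  have not_all: False if all: "poly f2 a = 0" "poly f2 (- b) = 0" "poly f2 g = 0"
  proof -
    have cub: "cubic a b g = smult e ([:- a, 1:] * ([:b, 1:] * [:- g, 1:]))"
      unfolding cubic_factor e_def by (simp only: mult.assoc)
    obtain k where k: "f2 = [:- a, 1:] * k"
      using all(1) by (auto simp: poly_eq_0_iff_dvd)
    have "(a + b) * poly k (- b) = 0" "(g - a) * poly k g = 0"
      using all(2,3) unfolding k by (simp_all add: algebra_simps)
    then have "poly k (- b) = 0" "poly k g = 0" using ab g by auto
    then have "[:- (- b), 1:] * [:- g, 1:] dvd k" using g by (intro two_roots_dvd) auto
    then have "cubic a b g dvd f2"
      unfolding cub k using e by (simp add: smult_dvd_iff del: mult_pCons_left mult_pCons_right)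
    then obtain \<kappa> where \<kappa>: "\<kappa> \<noteq> 0" "f1 = smult (1 / \<kappa>) 1" "f2 = smult \<kappa> (cubic a b g)"
      using factor_pair_eq_up_to_const[of f1 f2 1 "cubic a b g"] f cubic_neq_0[OF g(1)] by auto
    have "n = 2 * (degree s + 1) + 1"
      using degQ s \<kappa> degree_cubic[OF g(1)] cubic_neq_0[OF g(1)] by (simp add: degree_mult_eq)
    then have "odd n" by simp
    have "(poly r a)\<^sup>2 * (1 / \<kappa>) = - 2 * a ^ n" "(poly r (- b))\<^sup>2 * (1 / \<kappa>) = 2 * b ^ n"
      using PQ_root[of a] PQ_root[of "- b"] all \<open>odd n\<close> by (simp_all add: \<kappa>(2) power2_eq_square)
    moreover have "- 2 * a ^ n < 0" "2 * b ^ n > 0" using ab by simp_all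
    ultimately show False
      by (smt (verit) mult_nonneg_nonneg mult_nonneg_nonpos zero_le_power2)
  qed
  have cub: "cubic a b g = smult e ([:- a, 1:] * [:- (- b), 1:] * [:- g, 1:])"
    "cubic a b g = smult e ([:- a, 1:] * [:- g, 1:] * [:- (- b), 1:])"
    "cubic a b g = smult e ([:- (- b), 1:] * [:- g, 1:] * [:- a, 1:])"
    unfolding cubic_factor e_def minus_minus by (simp_all only: ac_simps)
  have nz: "a \<noteq> 0" "- b \<noteq> 0" "a \<noteq> - b" "- b \<noteq> g" "a \<noteq> g" "g \<noteq> 0" using ab g by auto
  have "poly f2 a = 0 \<or> poly f2 (- b) = 0" using a_root b_root signs(3) by blast
  then consider
    (og) "poly f2 a = 0" "poly f2 (- b) = 0" "poly f1 g = 0"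
  | (b) "poly f2 a = 0" "poly f1 (- b) = 0" "poly f2 g = 0"
  | (a) "poly f1 a = 0" "poly f2 (- b) = 0" "poly f2 g = 0"
  | (oa) "poly f2 a = 0" "poly f1 (- b) = 0" "poly f1 g = 0"
  | (ob) "poly f1 a = 0" "poly f2 (- b) = 0" "poly f1 g = 0"
    using ra rb rg not_all by blast
  then show ?thesis
  proof cases
    case og
    then have "poly r a \<noteq> 0" "poly r (- b) \<noteq> 0" using ra rb by auto
    from even_case[OF cub(1) nz(3) nz(1) nz(2) nz(6) og(1,2) this og(3)]
    obtain m s r where m: "m > 0" "n = 2 * m" "pade m m (Y / fps_of_poly [:- g, 1:]) s r"
      "e * (a - g) < 0" "e * (- b - g) < 0" by blast
    then have "g < - b \<or> a < g" by (auto simp: e_def sgn_if split: if_splits)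
    then show ?thesis using m by blast
  next
    case b
    then have "poly r a \<noteq> 0" "poly r g \<noteq> 0" using ra rg by auto
    from even_case[OF cub(2) nz(5) nz(1) nz(6) nz(2) b(1,3) this b(2)]
    obtain m s r where m: "m > 0" "n = 2 * m" "pade m m (Y / fps_of_poly [:- (- b), 1:]) s r"
      "e * (a - (- b)) < 0" "e * (g - (- b)) < 0" by blast
    then have "- b < g \<and> g < 0" using ab by (auto simp: e_def sgn_if split: if_splits)
    then show ?thesis using m by blast
  next
    case a
    then have "poly r (- b) \<noteq> 0" "poly r g \<noteq> 0" using rb rg by auto
    from even_case[OF cub(3) nz(4) nz(2) nz(6) nz(1) a(2,3) this a(1)]
    obtain m s r where m: "m > 0" "n = 2 * m" "pade m m (Y / fps_of_poly [:- a, 1:]) s r"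
      "e * (- b - a) < 0" "e * (g - a) < 0" by blast
    then have "0 < g \<and> g < a" using ab nz(6) by (auto simp: e_def sgn_if split: if_splits)
    then show ?thesis using m by blast
  next
    case oa
    then have "poly r a \<noteq> 0" using ra by auto
    from odd_case[OF cub(3) nz(4) nz(1) oa(2,3,1) this]
    obtain m s r where m: "m > 0" "n = 2 * m + 1" "pade m (m + 1) (Y / fps_of_poly [:- a, 1:]) s r"
      "e * (a - (- b)) * (a - g) * a < 0" by blast
    then have "\<not> (0 < g \<and> g < a)" using ab by (auto simp: e_def mult_less_0_iff)
    then show ?thesis using m by blast
  next
    case ob
    then have "poly r (- b) \<noteq> 0" using rb by auto
    from odd_case[OF cub(2) nz(5) nz(2) ob(1,3,2) this]
    obtain m s r where m: "m > 0" "n = 2 * m + 1" "pade m (m + 1) (Y / fps_of_poly [:- (- b), 1:]) s r"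
      "e * (- b - a) * (- b - g) * (- b) < 0" by blast
    then have "\<not> (- b < g \<and> g < 0)" using ab by (auto simp: e_def mult_less_0_iff zero_less_mult_iff)
    then show ?thesis using m by blast
  qed
qed

end

section \<open>Elliptic coordinates\<close>

lemma elliptic_coordinates_sum_prod:
  fixes a b :: real
  assumes ab: "a > 0" "b > 0" and p: "is_elliptic_coordinates a b (x, y) p"
  shows "fst p + snd p = a - b - x\<^sup>2 + y\<^sup>2" "fst p * snd p = b * x\<^sup>2 + a * y\<^sup>2 - a * b"
proof -
  define f where "f l = (a - l) * (b + l) - x\<^sup>2 * (b + l) - y\<^sup>2 * (a - l)" for l
  define u v where "u = fst p" and "v = a - b - x\<^sup>2 + y\<^sup>2 - u"
  have roots: "f l = 0 \<longleftrightarrow> l = u \<or> l = snd p" for l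
    using p mem_confocal_conic_iff[OF ab, of x y l]
    by (auto simp: is_elliptic_coordinates_def f_def u_def)
  have "f l - f u = - (l - u) * (l - v)" for l
    unfolding f_def v_def by (simp add: power2_eq_square algebra_simps)
  then have fac: "f l = - (l - u) * (l - v)" for l using roots[of u] by simp
  have v: "v = snd p"
    using roots[of v] roots[of "snd p"] by (auto simp: fac)
  then show "fst p + snd p = a - b - x\<^sup>2 + y\<^sup>2"
    by (simp add: v_def u_def)
  have "fst p * snd p = - f 0"
    using v by (simp add: fac u_def)
  then show "fst p * snd p = b * x\<^sup>2 + a * y\<^sup>2 - a * b"
    by (simp add: f_def algebra_simps)
qed

text \<open>Sum and product of the coordinates are affine functions of \<open>x^2\<close> and
  \<open>y^2\<close>, and the linear system is nonsingular because \<open>a + b > 0\<close>.\<close>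

lemma elliptic_coordinates_eq_iff:
  fixes a b :: real
  assumes ab: "a > 0" "b > 0"
    and inside: "x\<^sup>2 / a + y\<^sup>2 / b \<le> 1" "x'\<^sup>2 / a + y'\<^sup>2 / b \<le> 1"
  shows "elliptic_coordinates a b (x, y) = elliptic_coordinates a b (x', y') \<longleftrightarrow>
    x\<^sup>2 = x'\<^sup>2 \<and> y\<^sup>2 = y'\<^sup>2"
proof
  assume "x\<^sup>2 = x'\<^sup>2 \<and> y\<^sup>2 = y'\<^sup>2"
  then have "{l. (x, y) \<in> confocal_conic a b l} = {l. (x', y') \<in> confocal_conic a b l}"
    by (simp add: mem_confocal_conic_iff[OF ab])
  then show "elliptic_coordinates a b (x, y) = elliptic_coordinates a b (x', y')"
    by (simp add: elliptic_coordinates_def is_elliptic_coordinates_def)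
next
  assume eq: "elliptic_coordinates a b (x, y) = elliptic_coordinates a b (x', y')"
  have "is_elliptic_coordinates a b (x, y) (elliptic_coordinates a b (x, y))"
    "is_elliptic_coordinates a b (x', y') (elliptic_coordinates a b (x', y'))"
    using theI'[OF elliptic_coordinates_ex1[OF ab inside(1)]]
      theI'[OF elliptic_coordinates_ex1[OF ab inside(2)]]
    by (simp_all add: elliptic_coordinates_def)
  note sp = elliptic_coordinates_sum_prod[OF ab this(1)] elliptic_coordinates_sum_prod[OF ab this(2)]
  have *: "y\<^sup>2 - y'\<^sup>2 = x\<^sup>2 - x'\<^sup>2" "b * (x\<^sup>2 - x'\<^sup>2) + a * (y\<^sup>2 - y'\<^sup>2) = 0"
    using sp eq by (simp_all add: algebra_simps)
  then have "(a + b) * (x\<^sup>2 - x'\<^sup>2) = 0" unfolding *(1) by (simp add: distrib_right)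
  then have "x\<^sup>2 = x'\<^sup>2" using ab by auto
  then show "x\<^sup>2 = x'\<^sup>2 \<and> y\<^sup>2 = y'\<^sup>2" using * by simp
qed

lemma segment_in_ellipse:
  fixes a b t :: real
  assumes ab: "a > 0" "b > 0" and t: "0 \<le> t" "t \<le> 1"
    and P: "x\<^sup>2 / a + y\<^sup>2 / b = 1" and Q: "x'\<^sup>2 / a + y'\<^sup>2 / b = 1"
  shows "((1 - t) * x + t * x')\<^sup>2 / a + ((1 - t) * y + t * y')\<^sup>2 / b \<le> 1"
proof -
  have conv: "((1 - t) * z + t * z')\<^sup>2 \<le> (1 - t) * z\<^sup>2 + t * z'\<^sup>2" for z z' :: real
  proof -
    have "((1 - t) * z + t * z')\<^sup>2 = (1 - t) * z\<^sup>2 + t * z'\<^sup>2 - t * (1 - t) * (z - z')\<^sup>2"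
      by (simp add: power2_eq_square algebra_simps)
    then show ?thesis using t by simp
  qed
  have "((1 - t) * x + t * x')\<^sup>2 / a + ((1 - t) * y + t * y')\<^sup>2 / b \<le>
      ((1 - t) * x\<^sup>2 + t * x'\<^sup>2) / a + ((1 - t) * y\<^sup>2 + t * y'\<^sup>2) / b"
    using ab conv by (intro add_mono divide_right_mono) auto
  also have "\<dots> = (1 - t) * (x\<^sup>2 / a + y\<^sup>2 / b) + t * (x'\<^sup>2 / a + y'\<^sup>2 / b)"
    by (simp add: add_divide_distrib distrib_left)
  finally show ?thesis by (simp add: P Q)
qed

text \<open>The squares at the endpoints leave two independent signs; the square at the midpoint
  gives \<open>p' * q' = p * q\<close> and couples them.\<close>

lemma eq_up_to_common_sign:
  fixes p q p' q' :: real
  assumes "p'\<^sup>2 = p\<^sup>2" "q'\<^sup>2 = q\<^sup>2" "(p' / 2 + q' / 2)\<^sup>2 = (p / 2 + q / 2)\<^sup>2"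
  obtains \<sigma> where "\<sigma> = 1 \<or> \<sigma> = - 1" "p' = \<sigma> * p" "q' = \<sigma> * q"
proof -
  have "p' * q' = p * q"
    using assms by (simp add: power2_eq_square field_simps)
  moreover have "p' = p \<or> p' = - p" "q' = q \<or> q' = - q"
    using assms by (simp_all add: power2_eq_iff)
  ultimately have "p' = p \<and> q' = q \<or> p' = - p \<and> q' = - q"
    by auto
  then show ?thesis using that[of 1] that[of "- 1"] by auto
qed

lemma on_ellipse_iff:
  assumes "a > 0" "b > 0"
  shows "X \<in> confocal_conic a b 0 \<longleftrightarrow> (fst X)\<^sup>2 / a + (snd X)\<^sup>2 / b = 1"
  using assms by (cases X) (simp add: confocal_conic_def)

text \<open>Both ends and the midpoint of one segment suffice. The signs obtained may depend on
  \<open>k\<close>.\<close>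

lemma elliptic_periodic_imp_segment_symmetry:
  assumes ab: "a > 0" "b > 0" and on: "\<And>k. P k \<in> confocal_conic a b 0"
    and per: "elliptic_periodic a b n P"
  obtains \<sigma> \<tau> where "\<sigma> = 1 \<or> \<sigma> = - 1" "\<tau> = 1 \<or> \<tau> = - 1"
    "fst (P (k + n)) = \<sigma> * fst (P k)" "fst (P (Suc (k + n))) = \<sigma> * fst (P (Suc k))"
    "snd (P (k + n)) = \<tau> * snd (P k)" "snd (P (Suc (k + n))) = \<tau> * snd (P (Suc k))"
proof -
  have sq: "((1 - t) * fst (P (k + n)) + t * fst (P (Suc (k + n))))\<^sup>2 =
      ((1 - t) * fst (P k) + t * fst (P (Suc k)))\<^sup>2 \<and>
    ((1 - t) * snd (P (k + n)) + t * snd (P (Suc (k + n))))\<^sup>2 =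
      ((1 - t) * snd (P k) + t * snd (P (Suc k)))\<^sup>2" if "t \<in> {0..1}" for t
  proof -
    have pt: "(1 - t) *\<^sub>R P j + t *\<^sub>R P i =
        ((1 - t) * fst (P j) + t * fst (P i), (1 - t) * snd (P j) + t * snd (P i))" for i j
      by (simp add: prod_eq_iff)
    have "elliptic_coordinates a b ((1 - t) *\<^sub>R P (k + n) + t *\<^sub>R P (Suc (k + n))) =
        elliptic_coordinates a b ((1 - t) *\<^sub>R P k + t *\<^sub>R P (Suc k))"
      using per that unfolding elliptic_periodic_def by blast
    then show ?thesis
      unfolding pt using that on ab
      by (subst (asm) elliptic_coordinates_eq_iff) (auto intro!: segment_in_ellipse simp: on_ellipse_iff)
  qed
  have x: "(fst (P (k + n)))\<^sup>2 = (fst (P k))\<^sup>2" "(fst (P (Suc (k + n))))\<^sup>2 = (fst (P (Suc k)))\<^sup>2"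
      "(fst (P (k + n)) / 2 + fst (P (Suc (k + n))) / 2)\<^sup>2 = (fst (P k) / 2 + fst (P (Suc k)) / 2)\<^sup>2"
    and y: "(snd (P (k + n)))\<^sup>2 = (snd (P k))\<^sup>2" "(snd (P (Suc (k + n))))\<^sup>2 = (snd (P (Suc k)))\<^sup>2"
      "(snd (P (k + n)) / 2 + snd (P (Suc (k + n))) / 2)\<^sup>2 = (snd (P k) / 2 + snd (P (Suc k)) / 2)\<^sup>2"
    using sq[of 0] sq[of 1] sq[of "1 / 2"] by simp_all
  obtain \<sigma> where \<sigma>: "\<sigma> = 1 \<or> \<sigma> = - 1"
    "fst (P (k + n)) = \<sigma> * fst (P k)" "fst (P (Suc (k + n))) = \<sigma> * fst (P (Suc k))"
    by (rule eq_up_to_common_sign[OF x])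
  obtain \<tau> where \<tau>: "\<tau> = 1 \<or> \<tau> = - 1"
    "snd (P (k + n)) = \<tau> * snd (P k)" "snd (P (Suc (k + n))) = \<tau> * snd (P (Suc k))"
    by (rule eq_up_to_common_sign[OF y])
  show ?thesis
    by (rule that[OF \<sigma>(1) \<tau>(1) \<sigma>(2,3) \<tau>(2,3)])
qed

lemma symmetry_imp_elliptic_periodic:
  assumes ab: "a > 0" "b > 0" and on: "\<And>k. P k \<in> confocal_conic a b 0"
    and sym: "\<And>k. fst (P (k + n)) = \<sigma> * fst (P k)" "\<And>k. snd (P (k + n)) = \<tau> * snd (P k)"
    and signs: "\<sigma>\<^sup>2 = 1" "\<tau>\<^sup>2 = 1"
  shows "elliptic_periodic a b n P"
  unfolding elliptic_periodic_def
proof (intro allI ballI)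
  fix k and t :: real assume t: "t \<in> {0..1}"
  have pt: "(1 - t) *\<^sub>R P j + t *\<^sub>R P i =
      ((1 - t) * fst (P j) + t * fst (P i), (1 - t) * snd (P j) + t * snd (P i))" for i j
    by (simp add: prod_eq_iff)
  have "(1 - t) * fst (P (k + n)) + t * fst (P (Suc (k + n))) = \<sigma> * ((1 - t) * fst (P k) + t * fst (P (Suc k)))"
    "(1 - t) * snd (P (k + n)) + t * snd (P (Suc (k + n))) = \<tau> * ((1 - t) * snd (P k) + t * snd (P (Suc k)))"
    using sym[of k] sym[of "Suc k"] by (simp_all add: algebra_simps)
  then show "elliptic_coordinates a b ((1 - t) *\<^sub>R P (k + n) + t *\<^sub>R P (Suc (k + n))) =
      elliptic_coordinates a b ((1 - t) *\<^sub>R P k + t *\<^sub>R P (Suc k))"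
    unfolding pt using t on ab signs
    by (subst elliptic_coordinates_eq_iff)
       (auto intro!: segment_in_ellipse simp: on_ellipse_iff power_mult_distrib)
qed

section \<open>Billiard trajectories as orbits\<close>

text \<open>The tangent has direction \<open>(- X2 / b, X1 / a)\<close>, so the normal part of
  \<open>v\<close> is a multiple \<open>s\<close> of \<open>(X1 / a, - X2 / b)\<close>, and
  \<open>\<nu> = - 2 * s\<close>.\<close>

lemma mink_reflection_tangent:
  fixes a b X1 X2 :: real
  assumes ab: "a > 0" "b > 0" and on: "X1\<^sup>2 / a + X2\<^sup>2 / b = 1"
    and refl: "mink_reflection (conic_tangent a b 0 X1 X2 1) v v'"
  obtains \<nu> where "fst v' = fst v + \<nu> * X1 / a" "snd v' = snd v - \<nu> * X2 / b"
    "mink v' v' = mink v v"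
proof -
  let ?L = "conic_tangent a b 0 X1 X2 1"
  obtain p w where p: "parallel_to_line p ?L" and w: "orthogonal_to_line w ?L"
    and v: "v = p + w" "v' = p - w"
    using refl unfolding mink_reflection_def by blast
  have "X1 * (X1 - X2 / b) / a + X2 * (X2 + X1 / a) / b = X1\<^sup>2 / a + X2\<^sup>2 / b"
    by (simp add: power2_eq_square right_diff_distrib distrib_left diff_divide_distrib add_divide_distrib)
  then have "(X1, X2) \<in> ?L" "(X1 - X2 / b, X2 + X1 / a) \<in> ?L"
    using on by (simp_all add: conic_tangent_def power2_eq_square)
  then have "parallel_to_line (- X2 / b, X1 / a) ?L"
    unfolding parallel_to_line_def
    by (intro bexI[of _ "(X1, X2)"] bexI[of _ "(X1 - X2 / b, X2 + X1 / a)"]) auto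
  then have "mink w (- X2 / b, X1 / a) = 0"
    using w unfolding orthogonal_to_line_def by blast
  moreover define \<alpha> \<beta> where "\<alpha> = X1 / a" and "\<beta> = X2 / b"
  ultimately have wT: "fst w * \<beta> = - (snd w * \<alpha>)" "snd w * \<alpha> = - (fst w * \<beta>)"
    by (simp_all add: mink_def)
  have "\<alpha> \<noteq> 0 \<or> \<beta> \<noteq> 0" using on ab by (auto simp: \<alpha>_def \<beta>_def)
  then obtain s where ws: "fst w = s * \<alpha>" "snd w = - s * \<beta>"
  proof (elim disjE)
    assume "\<alpha> \<noteq> 0"
    then show ?thesis using wT(2) that[of "fst w / \<alpha>"] by (simp add: field_simps)
  next
    assume "\<beta> \<noteq> 0"
    then show ?thesis using wT(1) that[of "- snd w / \<beta>"] by (simp add: field_simps)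
  qed
  have "mink w p = 0"
    using w p unfolding orthogonal_to_line_def by blast
  then have "mink v' v' = mink v v"
    by (simp add: v mink_def algebra_simps)
  moreover have "fst v' = fst v + (- 2 * s) * X1 / a" "snd v' = snd v - (- 2 * s) * X2 / b"
    using ws by (simp_all add: v \<alpha>_def \<beta>_def)
  ultimately show ?thesis using that by blast
qed

text \<open>In line coordinates tangency is the dual conic equation
  \<open>(a - g) * \<xi>^2 + (b + g) * \<eta>^2 = z0^2\<close>. The normal
  \<open>(\<xi>, \<eta>)\<close> is a nonzero multiple of \<open>(q, - p)\<close>; asymptotes are
  included.\<close>

lemma tangent_to_conic_imp_caustic_eq:
  fixes a b g x y p q :: real
  assumes g: "g \<noteq> a" "g \<noteq> - b" and tang: "tangent_to_conic a b g L"
    and L: "(x, y) \<in> L" "(x + p, y + q) \<in> L" and pq: "p \<noteq> 0 \<or> q \<noteq> 0"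
  shows "(b + g) * p\<^sup>2 + (a - g) * q\<^sup>2 = (x * q - y * p)\<^sup>2"
proof -
  obtain x0 y0 z0 where nz: "(x0, y0, z0) \<noteq> (0, 0, 0)"
    and c: "x0\<^sup>2 / (a - g) + y0\<^sup>2 / (b + g) = z0\<^sup>2" and L_eq: "L = conic_tangent a b g x0 y0 z0"
    using tang unfolding tangent_to_conic_def by blast
  define \<xi> \<eta> where "\<xi> = x0 / (a - g)" and "\<eta> = y0 / (b + g)"
  have nonzero: "a - g \<noteq> 0" "b + g \<noteq> 0" using g by auto
  have "x0 = (a - g) * \<xi>" "y0 = (b + g) * \<eta>"
    using nonzero by (simp_all add: \<xi>_def \<eta>_def)
  note xy0 = this
  have "x0\<^sup>2 / (a - g) = (a - g) * \<xi>\<^sup>2" "y0\<^sup>2 / (b + g) = (b + g) * \<eta>\<^sup>2"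
    using nonzero unfolding xy0
    by (simp_all add: power_mult_distrib power2_eq_square[of "a - g"] power2_eq_square[of "b + g"])
  then have c: "(a - g) * \<xi>\<^sup>2 + (b + g) * \<eta>\<^sup>2 = z0\<^sup>2"
    using c by simp
  have z: "\<xi> * x + \<eta> * y = z0" and "\<xi> * (x + p) + \<eta> * (y + q) = z0"
    using L nonzero by (simp_all add: L_eq conic_tangent_def xy0 mult.commute)
  then have par: "\<xi> * p + \<eta> * q = 0" by (simp add: algebra_simps)
  obtain s where s: "\<xi> = s * q" "\<eta> = - s * p"
  proof (cases "q = 0")
    case True
    then show ?thesis using that[of "- \<eta> / p"] par pq by simp
  next
    case False
    have "\<eta> = - (\<xi> / q) * p" using False par by (simp add: field_simps eq_neg_iff_add_eq_0)
    then show ?thesis using that[of "\<xi> / q"] False by simp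
  qed
  have "s \<noteq> 0"
  proof
    assume "s = 0"
    then have "\<xi> = 0" "\<eta> = 0" using s by auto
    then show False using nz z xy0 by auto
  qed
  have "s\<^sup>2 * ((b + g) * p\<^sup>2 + (a - g) * q\<^sup>2) = s\<^sup>2 * (x * q - y * p)\<^sup>2"
    using c unfolding z[symmetric] s by (simp add: power2_eq_square algebra_simps)
  then show ?thesis using \<open>s \<noteq> 0\<close> by simp
qed

text \<open>For the last claim, a Lagrange identity turns the caustic equation into
  \<open>- a * b * g * (p^2 - q^2)\<close> being a square, which is nonzero by the chord
  equation.\<close>

lemma chord_identities:
  fixes a b g x y p q :: real
  assumes ab: "a > 0" "b > 0" and on: "b * x\<^sup>2 + a * y\<^sup>2 = a * b"
    and on': "b * (x + p)\<^sup>2 + a * (y + q)\<^sup>2 = a * b" and pq: "p \<noteq> 0 \<or> q \<noteq> 0"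
  shows "2 * (b * x * p + a * y * q) = - (b * p\<^sup>2 + a * q\<^sup>2)" "b * p\<^sup>2 + a * q\<^sup>2 > 0"
    and "(b + g) * p\<^sup>2 + (a - g) * q\<^sup>2 = (x * q - y * p)\<^sup>2 \<Longrightarrow> g * (p\<^sup>2 - q\<^sup>2) < 0"
proof -
  show eq: "2 * (b * x * p + a * y * q) = - (b * p\<^sup>2 + a * q\<^sup>2)"
    using on on' by (simp add: power2_eq_square algebra_simps)
  show pos: "b * p\<^sup>2 + a * q\<^sup>2 > 0"
    using ab pq by (auto intro: add_pos_nonneg add_nonneg_pos)
  assume c: "(b + g) * p\<^sup>2 + (a - g) * q\<^sup>2 = (x * q - y * p)\<^sup>2"
  have "(b * x * p + a * y * q)\<^sup>2 = (b * p\<^sup>2 + a * q\<^sup>2) * (b * x\<^sup>2 + a * y\<^sup>2) - a * b * (x * q - y * p)\<^sup>2"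
    by (simp add: power2_eq_square algebra_simps)
  also have "\<dots> = a * b * (- (g * (p\<^sup>2 - q\<^sup>2)))"
    unfolding on c[symmetric] by (simp add: algebra_simps)
  finally have "a * b * (- (g * (p\<^sup>2 - q\<^sup>2))) = (b * x * p + a * y * q)\<^sup>2" ..
  moreover have "(b * x * p + a * y * q)\<^sup>2 > 0"
    using eq pos by auto
  ultimately have "a * b * (- (g * (p\<^sup>2 - q\<^sup>2))) > 0" by simp
  then show "g * (p\<^sup>2 - q\<^sup>2) < 0"
    using mult_pos_pos[OF ab] by (metis neg_0_less_iff_less zero_less_mult_pos)
qed

lemma billiard_trajectory_imp_orbit:
  assumes ab: "a > 0" "b > 0" and g: "g \<notin> {- b, 0, a}"
    and traj: "billiard_trajectory a b P" and caus: "has_caustic a b g P"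
  obtains u v t w where "billiard_orbit a b g (\<lambda>k. fst (P k)) (\<lambda>k. snd (P k)) u v t w"
proof -
  define x y where "x k = fst (P k)" and "y k = snd (P k)" for k
  have P_eq: "P k = (x k, y k)" for k by (simp add: x_def y_def)
  have on1: "(x k)\<^sup>2 / a + (y k)\<^sup>2 / b = 1" for k
    using traj on_ellipse_iff[OF ab] by (auto simp: billiard_trajectory_def x_def y_def)
  have on: "b * (x k)\<^sup>2 + a * (y k)\<^sup>2 = a * b" for k
  proof -
    have "b * (x k)\<^sup>2 + a * (y k)\<^sup>2 = a * b * ((x k)\<^sup>2 / a + (y k)\<^sup>2 / b)"
      using ab by (simp add: distrib_left)
    then show ?thesis by (simp add: on1)
  qed
  define p q where "p k = x (Suc k) - x k" and "q k = y (Suc k) - y k" for k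
  have step: "x (Suc k) = x k + p k" "y (Suc k) = y k + q k" for k
    by (simp_all add: p_def q_def)
  have pq: "p k \<noteq> 0 \<or> q k \<noteq> 0" for k
    using traj by (auto simp: billiard_trajectory_def p_def q_def P_eq)
  have caustic: "(b + g) * (p k)\<^sup>2 + (a - g) * (q k)\<^sup>2 = (x k * q k - y k * p k)\<^sup>2" for k
  proof (rule tangent_to_conic_imp_caustic_eq[OF _ _ _ _ _ pq])
    show "tangent_to_conic a b g (affine hull {P k, P (Suc k)})"
      using caus by (simp add: has_caustic_def)
    show "(x k, y k) \<in> affine hull {P k, P (Suc k)}"
      "(x k + p k, y k + q k) \<in> affine hull {P k, P (Suc k)}"
      by (simp_all add: P_eq step hull_inc)
  qed (use g in auto)
  note chord = chord_identities[OF ab on on[of "Suc k" for k, unfolded step] pq]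
  have neg: "g * ((p k)\<^sup>2 - (q k)\<^sup>2) < 0" for k
    using chord(3) caustic by blast
  have "\<exists>c \<nu>. c > 0 \<and> c * p (Suc k) = p k + \<nu> * x (Suc k) / a \<and>
      c * q (Suc k) = q k - \<nu> * y (Suc k) / b \<and>
      c\<^sup>2 * ((p (Suc k))\<^sup>2 - (q (Suc k))\<^sup>2) = (p k)\<^sup>2 - (q k)\<^sup>2" for k
  proof -
    obtain c where c: "c > 0" "mink_reflection (conic_tangent a b 0 (x (Suc k)) (y (Suc k)) 1)
        (p k, q k) (c * p (Suc k), c * q (Suc k))"
      using traj unfolding billiard_trajectory_def p_def q_def P_eq by auto
    obtain \<nu> where \<nu>: "c * p (Suc k) = p k + \<nu> * x (Suc k) / a" "c * q (Suc k) = q k - \<nu> * y (Suc k) / b"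
      and energy: "mink (c * p (Suc k), c * q (Suc k)) (c * p (Suc k), c * q (Suc k)) = mink (p k, q k) (p k, q k)"
      using mink_reflection_tangent[OF ab on1 c(2)] by auto
    have "c\<^sup>2 * ((p (Suc k))\<^sup>2 - (q (Suc k))\<^sup>2) = (p k)\<^sup>2 - (q k)\<^sup>2"
      using energy unfolding mink_def by (simp add: power2_eq_square algebra_simps)
    then show ?thesis
      using c(1) \<nu> by blast
  qed
  then obtain c \<nu> where c: "\<And>k. c k > 0" "\<And>k. c k * p (Suc k) = p k + \<nu> k * x (Suc k) / a"
    "\<And>k. c k * q (Suc k) = q k - \<nu> k * y (Suc k) / b"
    "\<And>k. (c k)\<^sup>2 * ((p (Suc k))\<^sup>2 - (q (Suc k))\<^sup>2) = (p k)\<^sup>2 - (q k)\<^sup>2"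
    by metis
  \<comment> \<open>The times are chosen so that displacement over time has Minkowski square
    \<open>- sgn g\<close>; dividing by \<open>c k\<close> compensates the free factor in the
    reflection law.\<close>
  define t where "t = rec_nat (sqrt \<bar>(p 0)\<^sup>2 - (q 0)\<^sup>2\<bar>) (\<lambda>k s. s / c k)"
  have t_Suc: "t (Suc k) = t k / c k" for k
    by (simp add: t_def)
  have t_pos: "t k > 0" for k
  proof (induction k)
    case 0
    show ?case using neg[of 0] by (auto simp: t_def)
  qed (use c in \<open>simp add: t_Suc\<close>)
  define u v w where "u k = p k / t k" and "v k = q k / t k" and "w k = \<nu> k / t k" for k
  have pt: "p k = t k * u k" "q k = t k * v k" for k
    using t_pos[of k] by (simp_all add: u_def v_def)
  have energy: "(p k)\<^sup>2 - (q k)\<^sup>2 = - sgn g * (t k)\<^sup>2" for k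
  proof (induction k)
    case 0
    show ?case using neg[of 0] by (auto simp: t_def sgn_if mult_less_0_iff)
  next
    case (Suc k)
    have "(c k)\<^sup>2 * ((p (Suc k))\<^sup>2 - (q (Suc k))\<^sup>2) = (c k)\<^sup>2 * (- sgn g * (t (Suc k))\<^sup>2)"
      unfolding c(4) Suc t_Suc using c(1)[of k] by (simp add: power_divide)
    moreover have "(c k)\<^sup>2 \<noteq> 0" using c(1)[of k] by simp
    ultimately show ?case using mult_left_cancel by blast
  qed
  have "billiard_orbit a b g x y u v t w"
  proof
    fix k
    show "b * (x k)\<^sup>2 + a * (y k)\<^sup>2 = a * b" "t k > 0" by (fact on t_pos)+
    show "x (Suc k) = x k + t k * u k" "y (Suc k) = y k + t k * v k"
      by (simp_all add: step pt)
    have "u (Suc k) = c k * p (Suc k) / t k" "v (Suc k) = c k * q (Suc k) / t k"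
      by (simp_all add: u_def v_def t_Suc)
    then show "u (Suc k) = u k + w k * x (Suc k) / a" "v (Suc k) = v k - w k * y (Suc k) / b"
      unfolding c(2,3) by (simp_all add: u_def v_def w_def add_divide_distrib diff_divide_distrib)
    have "(t k)\<^sup>2 * ((u k)\<^sup>2 - (v k)\<^sup>2) = (t k)\<^sup>2 * (- sgn g)"
      using energy[of k] unfolding pt by (simp add: power_mult_distrib algebra_simps)
    moreover have t2: "(t k)\<^sup>2 \<noteq> 0" using t_pos[of k] by simp
    ultimately show "(u k)\<^sup>2 - (v k)\<^sup>2 = - sgn g"
      using mult_left_cancel by blast
    have "(t k)\<^sup>2 * ((b + g) * (u k)\<^sup>2 + (a - g) * (v k)\<^sup>2) = (t k)\<^sup>2 * (x k * v k - y k * u k)\<^sup>2"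
      using caustic[of k] unfolding pt by (simp add: power2_eq_square algebra_simps)
    then show "(b + g) * (u k)\<^sup>2 + (a - g) * (v k)\<^sup>2 = (x k * v k - y k * u k)\<^sup>2"
      using t2 mult_left_cancel by blast
    \<comment> \<open>Without a kick the direction would stay the same, but at the vertex the old
      chord points outward and the new one inward.\<close>
    show "w k \<noteq> 0"
    proof
      assume "w k = 0"
      then have "\<nu> k = 0" using t_pos[of k] by (simp add: w_def)
      then have same: "c k * p (Suc k) = p k" "c k * q (Suc k) = q k" using c(2,3) by simp_all
      have "2 * (b * x (Suc k) * p k + a * y (Suc k) * q k) =
          c k * (2 * (b * x (Suc k) * p (Suc k) + a * y (Suc k) * q (Suc k)))"
        unfolding same[symmetric] by (simp add: algebra_simps)
      also have "\<dots> < 0"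
        using chord(1)[of "Suc k"] chord(2)[of "Suc k"] c(1)[of k] by (simp add: mult_pos_neg)
      also have "2 * (b * x (Suc k) * p k + a * y (Suc k) * q k) = b * (p k)\<^sup>2 + a * (q k)\<^sup>2"
        using chord(1)[of k] unfolding step by (simp add: power2_eq_square algebra_simps)
      finally show False using chord(2)[of k] by simp
    qed
  qed (use ab g in auto)
  then show ?thesis using that unfolding x_def y_def by blast
qed

section \<open>The criterion\<close>

lemma (in billiard_orbit_root) shifted_orbit:
  "billiard_orbit_root a b g (\<lambda>j. x (k + j)) (\<lambda>j. y (k + j)) (\<lambda>j. u (k + j)) (\<lambda>j. v (k + j))
     (\<lambda>j. t (k + j)) (\<lambda>j. w (k + j)) Y"
  using ab g on_ellipse t_pos w_nonzero x_step y_step u_step v_step energy caustic Y_square Y_pos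
  by unfold_locales auto

lemma pade_imp_elliptic_periodic:
  fixes h h' s r :: "real poly"
  assumes orbit: "billiard_orbit_root a b g (\<lambda>k. fst (P k)) (\<lambda>k. snd (P k)) u v t w Y"
    and on: "\<And>k. P k \<in> confocal_conic a b 0"
    and h: "degree h = 1" "h * h' = cubic a b g" "poly h 0 \<noteq> 0"
    and pade: "pade m K (Y / fps_of_poly h) s r"
    and K: "K = m \<or> K = Suc m" and n: "n = m + K" "n \<ge> 2"
    and nontrivial: "(poly h a = 0) \<noteq> (K = m) \<or> (poly h (- b) = 0) \<noteq> (K = m)"
  shows "elliptic_periodic a b n P \<and> \<not> periodic_trajectory n P"
proof -
  interpret billiard_orbit_root a b g "\<lambda>k. fst (P k)" "\<lambda>k. snd (P k)" u v t w Y by fact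
  define \<tau> where "\<tau> z = (if (poly h z = 0) = (K = m) then 1 else -1 :: real)" for z
  \<comment> \<open>The approximant does not refer to the starting vertex, so the same signs hold
    along the whole orbit.\<close>
  have sym: "fst (P (k + n)) = \<tau> a * fst (P k)" "u (k + n) = \<tau> a * u k"
    "snd (P (k + n)) = \<tau> (- b) * snd (P k)" "v (k + n) = \<tau> (- b) * v k" for k
    using billiard_orbit_root.pade_imp_symmetry[OF shifted_orbit[of k] h pade K n]
    by (simp_all add: \<tau>_def)
  have "elliptic_periodic a b n P"
    by (rule symmetry_imp_elliptic_periodic[where \<sigma> = "\<tau> a" and \<tau> = "\<tau> (- b)", OF ab on])
       (use sym(1,3) in \<open>simp_all add: \<tau>_def\<close>)
  moreover have "\<not> periodic_trajectory n P"
  proof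
    assume per: "periodic_trajectory n P"
    \<comment> \<open>Periodicity together with a sign \<open>- 1\<close> would put all vertices on
      one axis.\<close>
    have "\<tau> a = - 1 \<or> \<tau> (- b) = - 1" using nontrivial by (auto simp: \<tau>_def)
    then have "(\<forall>k. fst (P k) = 0) \<or> (\<forall>k. snd (P k) = 0)"
      using per sym(1,3) by (auto simp: periodic_trajectory_def)
    then show False
      using phase_point_neq_0[of 0] x_step[of 0] y_step[of 0] t_pos[of 0] by auto
  qed
  ultimately show ?thesis ..
qed

lemma elliptic_periodic_imp_pade:
  assumes orbit: "billiard_orbit_root a b g (\<lambda>k. fst (P k)) (\<lambda>k. snd (P k)) u v t w Y"
    and on: "\<And>k. P k \<in> confocal_conic a b 0"
    and per: "elliptic_periodic a b n P" "\<not> periodic_trajectory n P" and n: "n \<ge> 2"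
  shows "(\<exists>m>0. n = 2 * m \<and> (\<exists>\<rho> s r. pade m m (Y / fps_of_poly [:- \<rho>, 1:]) s r \<and>
            (\<rho> = a \<and> 0 < g \<and> g < a \<or> \<rho> = - b \<and> - b < g \<and> g < 0 \<or> \<rho> = g \<and> (g < - b \<or> a < g)))) \<or>
         (\<exists>m>0. n = 2 * m + 1 \<and> (\<exists>\<rho> s r. pade m (m + 1) (Y / fps_of_poly [:- \<rho>, 1:]) s r \<and>
            (\<rho> = a \<and> \<not> (0 < g \<and> g < a) \<or> \<rho> = - b \<and> \<not> (- b < g \<and> g < 0))))"
proof -
  interpret billiard_orbit_root a b g "\<lambda>k. fst (P k)" "\<lambda>k. snd (P k)" u v t w Y by fact
  obtain k where k: "P (k + n) \<noteq> P k"
    using per(2) by (auto simp: periodic_trajectory_def)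
  obtain \<sigma> \<tau> where signs: "\<sigma> = 1 \<or> \<sigma> = - 1" "\<tau> = 1 \<or> \<tau> = - 1"
    and X: "fst (P (k + n)) = \<sigma> * fst (P k)" "fst (P (Suc (k + n))) = \<sigma> * fst (P (Suc k))"
      "snd (P (k + n)) = \<tau> * snd (P k)" "snd (P (Suc (k + n))) = \<tau> * snd (P (Suc k))"
    using elliptic_periodic_imp_segment_symmetry[OF ab on per(1)] by metis
  have nontrivial: "\<sigma> = - 1 \<or> \<tau> = - 1"
    using k X(1,3) signs by (auto simp: prod_eq_iff)
  have "t (k + n) * u (k + n) = fst (P (Suc (k + n))) - fst (P (k + n))"
    "t (k + n) * v (k + n) = snd (P (Suc (k + n))) - snd (P (k + n))"
    using x_step[of "k + n"] y_step[of "k + n"] by simp_all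
  then have tu: "t (k + n) * u (k + n) = \<sigma> * (t k * u k)" and tv: "t (k + n) * v (k + n) = \<tau> * (t k * v k)"
    unfolding X x_step[of k] y_step[of k] by (simp_all add: algebra_simps)
  \<comment> \<open>Equal Minkowski squares of the displacements give equal flight times, so the
    velocities have the same symmetry as the vertices.\<close>
  have "(t (k + n))\<^sup>2 * ((u (k + n))\<^sup>2 - (v (k + n))\<^sup>2) =
      (t (k + n) * u (k + n))\<^sup>2 - (t (k + n) * v (k + n))\<^sup>2"
    by (simp add: power_mult_distrib algebra_simps)
  also have "\<dots> = (t k)\<^sup>2 * ((u k)\<^sup>2 - (v k)\<^sup>2)"
    unfolding tu tv using signs by (auto simp: power_mult_distrib algebra_simps)
  finally have "(t (k + n))\<^sup>2 = (t k)\<^sup>2"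
    unfolding energy using g by (simp add: sgn_zero_iff)
  then have "t (k + n) = t k"
    using t_pos[of k] t_pos[of "k + n"] by (simp add: power2_eq_iff)
  then have V: "u (k + n) = \<sigma> * u k" "v (k + n) = \<tau> * v k"
    using tu tv t_pos[of k] by (auto simp: algebra_simps)
  show ?thesis
    using billiard_orbit_root.symmetry_imp_pade[OF shifted_orbit[of k] n, of \<sigma> \<tau>]
      X(1,3) V signs nontrivial by simp
qed

theorem theorem5p3:
  fixes a b \<gamma> :: real and n :: nat and P :: "nat \<Rightarrow> real \<times> real"
  assumes "a > 0" and "b > 0"
    and "\<gamma> \<notin> {- b, 0, a}"
    and "n \<ge> 2"
    and "billiard_trajectory a b P"
    and "has_caustic a b \<gamma> P"
  shows "elliptic_periodic a b n P \<and> \<not> periodic_trajectory n P \<longleftrightarrow>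
    (0 < \<gamma> \<and> \<gamma> < a \<and>
       ((\<exists>m. n = 2 * m \<and> hankel_det 1 m (coeff_D a b \<gamma>) = 0) \<or>
        (\<exists>m. n = 2 * m + 1 \<and> hankel_det 2 m (coeff_E a b \<gamma>) = 0))) \<or>
    (- b < \<gamma> \<and> \<gamma> < 0 \<and>
       ((\<exists>m. n = 2 * m \<and> hankel_det 1 m (coeff_E a b \<gamma>) = 0) \<or>
        (\<exists>m. n = 2 * m + 1 \<and> hankel_det 2 m (coeff_D a b \<gamma>) = 0))) \<or>
    ((\<gamma> < - b \<or> a < \<gamma>) \<and> (\<exists>m. n = 2 * m \<and> hankel_det 1 m (coeff_C a b \<gamma>) = 0)) \<or>
    ((\<gamma> < - b \<or> a < \<gamma>) \<and> (\<exists>m. n = 2 * m + 1 \<and> hankel_det 2 m (coeff_D a b \<gamma>) = 0)) \<or>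
    ((\<gamma> < - b \<or> a < \<gamma>) \<and> (\<exists>m. n = 2 * m + 1 \<and> hankel_det 2 m (coeff_E a b \<gamma>) = 0))"
    (is "?periodic \<longleftrightarrow> ?cond")
proof -
  note ab = assms(1,2)
  have \<gamma>: "\<gamma> \<noteq> 0" "\<gamma> \<noteq> a" "\<gamma> \<noteq> - b" using assms(3) by auto
  have on: "P k \<in> confocal_conic a b 0" for k
    using assms(5) by (simp add: billiard_trajectory_def)
  obtain Y where Y: "Y * Y = fps_of_poly (cubic a b \<gamma>)" "fps_nth Y 0 > 0"
    and taylor: "\<And>h k. poly h 0 \<noteq> 0 \<Longrightarrow>
      taylor_coeff (\<lambda>x. root_fun a b \<gamma> x / poly h x) k = fps_nth (Y / fps_of_poly h) k"
    using root_fun_series[OF ab \<gamma>(1)] by blast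
  obtain u v t w where "billiard_orbit a b \<gamma> (\<lambda>k. fst (P k)) (\<lambda>k. snd (P k)) u v t w"
    using billiard_trajectory_imp_orbit[OF ab assms(3,5,6)] by blast
  then have orbit: "billiard_orbit_root a b \<gamma> (\<lambda>k. fst (P k)) (\<lambda>k. snd (P k)) u v t w Y"
    using Y by (simp add: billiard_orbit_root_def billiard_orbit_root_axioms_def)
  define A B G where "A = [:a, - 1:]" and "B = [:b, 1:]" and "G = [:\<gamma>, - 1:]"
  have D: "coeff_D a b \<gamma> = fps_nth (Y / fps_of_poly A)"
    and E: "coeff_E a b \<gamma> = fps_nth (Y / fps_of_poly B)"
    and C: "coeff_C a b \<gamma> = fps_nth (Y / fps_of_poly G)"
    using taylor[of A] taylor[of B] taylor[of G] ab \<gamma>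
    by (auto simp: coeff_D_def coeff_E_def coeff_C_def A_def B_def G_def fun_eq_iff)
  have even_iff: "(\<exists>m. n = 2 * m \<and> hankel_det 1 m (fps_nth F) = 0) \<longleftrightarrow>
      (\<exists>m s r. n = 2 * m \<and> pade m m F s r)" for F
  proof -
    have "hankel_det 1 m (fps_nth F) = 0 \<longleftrightarrow> (\<exists>s r. pade m m F s r)" if "n = 2 * m" for m
      using hankel_det_eq_0_iff_pade[of m 0 F] that assms(4) by simp
    then show ?thesis by blast
  qed
  have odd_iff: "(\<exists>m. n = 2 * m + 1 \<and> hankel_det 2 m (fps_nth F) = 0) \<longleftrightarrow>
      (\<exists>m s r. n = 2 * m + 1 \<and> pade m (Suc m) F s r)" for F
  proof -
    have "hankel_det 2 m (fps_nth F) = 0 \<longleftrightarrow> (\<exists>s r. pade m (Suc m) F s r)" if "n = 2 * m + 1" for m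
      using hankel_det_eq_0_iff_pade[of m 1 F] that assms(4) by (simp add: numeral_2_eq_2)
    then show ?thesis by blast
  qed
  note iffs = D E C even_iff odd_iff
  show ?thesis
  proof
    assume ?periodic
    then have per: "elliptic_periodic a b n P" "\<not> periodic_trajectory n P" by auto
    have flip: "\<exists>s r. pade m K (Y / fps_of_poly A) s r" if "pade m K (Y / fps_of_poly [:- a, 1:]) s r" for m K s r
      using pade_uminus[OF _ that] ab by (auto simp: A_def)
    have flip': "\<exists>s r. pade m K (Y / fps_of_poly G) s r" if "pade m K (Y / fps_of_poly [:- \<gamma>, 1:]) s r" for m K s r
      using pade_uminus[OF _ that] \<gamma> by (auto simp: G_def)
    from elliptic_periodic_imp_pade[OF orbit on per assms(4)]
    show ?cond
    proof (elim disjE exE conjE)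
      fix m \<rho> s r
      assume m: "n = 2 * m" and p: "pade m m (Y / fps_of_poly [:- \<rho>, 1:]) s r"
      {
        assume "\<rho> = a" "0 < \<gamma>" "\<gamma> < a"
        then show ?cond using m flip[of m m s r] p unfolding iffs by blast
      next
        assume "\<rho> = - b" "- b < \<gamma>" "\<gamma> < 0"
        then show ?cond using m p unfolding iffs B_def by auto
      next
        assume "\<rho> = \<gamma>" "\<gamma> < - b"
        then show ?cond using m flip'[of m m s r] p unfolding iffs by blast
      next
        assume "\<rho> = \<gamma>" "a < \<gamma>"
        then show ?cond using m flip'[of m m s r] p unfolding iffs by blast
      }
    next
      fix m \<rho> s r
      assume m: "n = 2 * m + 1" and p: "pade m (m + 1) (Y / fps_of_poly [:- \<rho>, 1:]) s r"
      {
        assume "\<rho> = a" "\<not> (0 < \<gamma> \<and> \<gamma> < a)"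
        moreover from this have "- b < \<gamma> \<and> \<gamma> < 0 \<or> \<gamma> < - b \<or> a < \<gamma>" using \<gamma> by linarith
        moreover have "\<exists>m s r. n = 2 * m + 1 \<and> pade m (Suc m) (Y / fps_of_poly A) s r"
          using m flip p \<open>\<rho> = a\<close> by (metis Suc_eq_plus1)
        ultimately show ?cond unfolding iffs by blast
      next
        assume "\<rho> = - b" "\<not> (- b < \<gamma> \<and> \<gamma> < 0)"
        moreover from this have "0 < \<gamma> \<and> \<gamma> < a \<or> \<gamma> < - b \<or> a < \<gamma>" using \<gamma> by linarith
        moreover have "\<exists>m s r. n = 2 * m + 1 \<and> pade m (Suc m) (Y / fps_of_poly B) s r"
          using m p \<open>\<rho> = - b\<close> by (auto simp: B_def)
        ultimately show ?cond unfolding iffs by blast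
      }
    qed
  next
    assume cond: ?cond
    have cub: "A * smult (sgn \<gamma>) (B * G) = cubic a b \<gamma>" "B * smult (sgn \<gamma>) (A * G) = cubic a b \<gamma>"
      "G * smult (sgn \<gamma>) (A * B) = cubic a b \<gamma>"
      by (simp_all only: cubic_def A_def B_def G_def mult_smult_right ac_simps)
    have deg: "degree A = 1" "degree B = 1" "degree G = 1"
      and zero: "poly A 0 \<noteq> 0" "poly B 0 \<noteq> 0" "poly G 0 \<noteq> 0"
      and at_a: "poly A a = 0" "poly B a \<noteq> 0" "poly G a \<noteq> 0"
      and at_b: "poly A (- b) \<noteq> 0" "poly B (- b) = 0" "poly G (- b) \<noteq> 0"
      using ab \<gamma> by (simp_all add: A_def B_def G_def)
    \<comment> \<open>For even \<open>n\<close> the sign is \<open>- 1\<close> where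
      \<open>h\<close> does not vanish, so each of \<open>A\<close>, \<open>B\<close>,
      \<open>G\<close> gives a nontrivial symmetry. For odd \<open>n\<close> it is
      \<open>- 1\<close> at a root of \<open>h\<close>, which must be \<open>a\<close> or
      \<open>- b\<close>, leaving \<open>A\<close> and \<open>B\<close>.\<close>
    note criterion = pade_imp_elliptic_periodic[OF orbit on]
    have even: ?periodic if m: "n = 2 * m"
      and "pade m m (Y / fps_of_poly A) s r \<or> pade m m (Y / fps_of_poly B) s r \<or>
        pade m m (Y / fps_of_poly G) s r" for m s r
      using that(2)
    proof (elim disjE)
      assume "pade m m (Y / fps_of_poly A) s r"
      from criterion[where n = n, OF deg(1) cub(1) zero(1) this] show ?periodic
        using m assms(4) at_a at_b by simp
    next
      assume "pade m m (Y / fps_of_poly B) s r"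
      from criterion[where n = n, OF deg(2) cub(2) zero(2) this] show ?periodic
        using m assms(4) at_a at_b by simp
    next
      assume "pade m m (Y / fps_of_poly G) s r"
      from criterion[where n = n, OF deg(3) cub(3) zero(3) this] show ?periodic
        using m assms(4) at_a at_b by simp
    qed
    have odd: ?periodic if m: "n = 2 * m + 1"
      and "pade m (Suc m) (Y / fps_of_poly A) s r \<or> pade m (Suc m) (Y / fps_of_poly B) s r" for m s r
      using that(2)
    proof (elim disjE)
      assume "pade m (Suc m) (Y / fps_of_poly A) s r"
      from criterion[where n = n, OF deg(1) cub(1) zero(1) this] show ?periodic
        using m assms(4) at_a at_b by simp
    next
      assume "pade m (Suc m) (Y / fps_of_poly B) s r"
      from criterion[where n = n, OF deg(2) cub(2) zero(2) this] show ?periodic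
        using m assms(4) at_a at_b by simp
    qed
    show ?periodic
      using cond unfolding iffs using even odd by blast
  qed
qed

end
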